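(* Let $(X,\mu)$ be a computable probability space, $n\ge 1$, and $A\subseteq\mathbb N$. If $x\in X$ is both Schnorr $n$-random relative to $A$ and weakly quasi-$\Pi^0_n$-generic relative to $A$, then for any $\Pi^0_n(A)$ set $P\ni x$ with $\mu(P)>0$ and any computable ergodic measure-preserving transformation $T:\subseteq X\to X$ with $x\in\operatorname{dom}T$, we have $T^k(x)\in P$ for some $k>0$.
   Context: Uniformity: a sequence of objects has a property (whose definition involves an index in $\mathbb N$) uniformly if a computable function produces suitable indices. $A^{(m)}$ denotes the $m$-th Turing jump of $A$. A computable metric space is a triple $(X,d,S)$ where $(X,d)$ is a complete separable metric space, $S=(s_i)_i$ is a dense sequence in $X$, and $d(s_i,s_j)$ is a computable real number uniformly in $i,j$. With $(q_j)_j$ a fixed enumeration of the positive rationals and $\langle\cdot,\cdot\rangle$ the standard pairing function, the ideal balls are $B_{\langle i,j\rangle}=\{x\in X: d(x,s_i)<q_j\}$. For an oracle $A\subseteq\mathbb N$: a set $U\subseteq X$ is $\Sigma^0_1(A)$ if $U=\bigcup_{i\in W}B_i$ for some $A$-c.e. $W\subseteq\mathbb N$ (its index is an index of $W$). A set is $\Pi^0_n(A)$ if its complement is $\Sigma^0_n(A)$. A set is $\Sigma^0_{n+1}(A)$ if it equals $\bigcup_{i\in W}(X\setminus U^n_i)$ for some $A$-c.e. $W\subseteq\mathbb N$, where $U^n_i$ is the $i$-th $\Sigma^0_n(A)$ set. Omit $(A)$ when $A=\emptyset$. For $D\subseteq X$, a subset of $D$ is $\Sigma^0_1$ in $D$ if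 it is the intersection of $D$ with a $\Sigma^0_1$ subset of $X$. A computable probability space $(X,\mu)$ is a computable metric space with a Borel probability measure $\mu$ such that $\mu(\bigcup_{i\in F}B_i)$ is lower-semicomputable uniformly in finite $F\subseteq\mathbb N$. A Schnorr $n$-test relative to $A$ is a sequence $(U_k)_k$ of uniformly $\Sigma^0_n(A)$ sets with $\mu(U_k)\le 2^{-k}$ for all $k$ and $\mu(U_k)$ uniformly $A^{(n-1)}$-computable in $k$. A point $x$ is Schnorr $n$-random relative to $A$ if $x\notin\bigcap_kU_k$ for every such test. A point $x\in X$ is weakly quasi-$\Pi^0_n$-generic relative to $A$ if for any $\Pi^0_n(A)$ set $P\ni x$ there is a $\Pi^0_1(A^{(n-1)})$ set $Q\subseteq P$ such that $\mu(Q)>0$ and $\mu(Q)$ is $A^{(n-1)}$-computable. A measure-preserving transformation is a partial Borel measurable map $T:\subseteq X\to X$ such that $\mu(T^{-1}(B))=\mu(B)$ for every Borel $B$ (so $\operatorname{dom}T$ has full measure) and $x\in\operatorname{dom}T$ implies $T(x)\in\operatorname{dom}T$. It is computable if the sets $T^{-1}(B_i)$ are uniformly $\Sigma^0_1$ in $\operatorname{dom}T$. It is ergodic if every Borel $B$ with $T^{-1}(B)=B$ has measure $0$ or $1$. *)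

theory Defs
  imports "HOL-Probability.Probability_Measure" "HOL-Library.Countable" "HOL-Library.Nat_Bijection"
begin

section \<open>Computability relative to a set of natural numbers\<close>

text \<open>
  Programs for partial recursive functions of one argument with access to a set \<open>A\<close>. Tuples of
  arguments are coded by the Cantor pairing function \<^const>\<open>prod_encode\<close>.
\<close>

datatype program =
    Zero | Succ | Fst | Snd | Query
  | Tuple program program | Comp program program | Prim program program | Mu program

inductive computes :: "nat set \<Rightarrow> program \<Rightarrow> nat \<Rightarrow> nat \<Rightarrow> bool" for A where
  "computes A Zero x 0"
| "computes A Succ x (Suc x)"
| "computes A Fst x (fst (prod_decode x))"
| "computes A Snd x (snd (prod_decode x))"
| "computes A Query x (if x \<in> A then 1 else 0)"
| "computes A p x y \<Longrightarrow> computes A q x z \<Longrightarrow> computes A (Tuple p q) x (prod_encode (y, z))"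
| "computes A q x y \<Longrightarrow> computes A p y z \<Longrightarrow> computes A (Comp p q) x z"
| "computes A p x y \<Longrightarrow> computes A (Prim p q) (prod_encode (x, 0)) y"
| "computes A (Prim p q) (prod_encode (x, m)) y \<Longrightarrow>
   computes A q (prod_encode (x, prod_encode (m, y))) z \<Longrightarrow>
   computes A (Prim p q) (prod_encode (x, Suc m)) z"
| "computes A p (prod_encode (x, m)) 0 \<Longrightarrow>
   (\<forall>l<m. \<exists>y>0. computes A p (prod_encode (x, l)) y) \<Longrightarrow>
   computes A (Mu p) x m"

text \<open>An effective numbering of all programs.\<close>

lemma fst_prod_decode_le: "fst (prod_decode k) \<le> k"
  by (metis le_prod_encode_1 prod.collapse prod_decode_inverse)

lemma snd_prod_decode_le: "snd (prod_decode k) \<le> k"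
  by (metis le_prod_encode_2 prod.collapse prod_decode_inverse)

function program_of :: "nat \<Rightarrow> program" where
  "program_of e =
    (if e = 0 then Zero else if e = 1 then Succ else if e = 2 then Fst else if e = 3 then Snd
     else if e = 4 then Query
     else let k = (e - 5) div 4; r = (e - 5) mod 4;
              a = fst (prod_decode k); b = snd (prod_decode k) in
       if r = 0 then Tuple (program_of a) (program_of b)
       else if r = 1 then Comp (program_of a) (program_of b)
       else if r = 2 then Prim (program_of a) (program_of b)
       else Mu (program_of k))"
  by auto
termination
proof (relation "Wellfounded.measure id")
  show "wf (Wellfounded.measure (id :: nat \<Rightarrow> nat))" by simp
qed (use le_less_trans[OF fst_prod_decode_le] le_less_trans[OF snd_prod_decode_le] in
     force)+

declare program_of.simps [simp del]

definition ce_set :: "nat set \<Rightarrow> nat \<Rightarrow> nat set" where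
  "ce_set A e = {x. \<exists>y. computes A (program_of e) x y}"

definition turing_jump :: "nat set \<Rightarrow> nat set" where
  "turing_jump A = {e. e \<in> ce_set A e}"

definition computable_fun :: "(nat \<Rightarrow> nat) \<Rightarrow> bool" where
  "computable_fun f \<longleftrightarrow> (\<exists>p. \<forall>x. computes {} p x (f x))"

text \<open>
  A property whose definition involves an index is represented by a relation \<open>R\<close>, where \<open>R e z\<close>
  says that \<open>e\<close> is an index witnessing the property for \<open>z\<close>.
\<close>

definition uniformly :: "(nat \<Rightarrow> 'b \<Rightarrow> bool) \<Rightarrow> (nat \<Rightarrow> 'b) \<Rightarrow> bool" where
  "uniformly R z \<longleftrightarrow> (\<exists>f. computable_fun f \<and> (\<forall>k. R (f k) (z k)))"

text \<open>\<^const>\<open>nat_to_rat_surj\<close> serves as the effective enumeration of all rationals.\<close>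

definition computable_real_index :: "nat set \<Rightarrow> nat \<Rightarrow> real \<Rightarrow> bool" where
  "computable_real_index A e r \<longleftrightarrow>
     (\<forall>m. \<exists>j. computes A (program_of e) m j \<and> \<bar>r - of_rat (nat_to_rat_surj j)\<bar> \<le> 1 / 2 ^ m)"

definition computable_real :: "nat set \<Rightarrow> real \<Rightarrow> bool" where
  "computable_real A r \<longleftrightarrow> (\<exists>e. computable_real_index A e r)"

definition lower_semicomputable_index :: "nat \<Rightarrow> real \<Rightarrow> bool" where
  "lower_semicomputable_index e r \<longleftrightarrow> ce_set {} e = {j. of_rat (nat_to_rat_surj j) < r}"


section \<open>Computable metric spaces and the effective Borel hierarchy\<close>

definition computable_metric_space :: "(nat \<Rightarrow> 'a::polish_space) \<Rightarrow> bool" where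
  "computable_metric_space s \<longleftrightarrow>
     closure (range s) = UNIV \<and>
     uniformly (computable_real_index {})
       (\<lambda>k. dist (s (fst (prod_decode k))) (s (snd (prod_decode k))))"

definition pos_rat :: "nat \<Rightarrow> real" where
  "pos_rat j = real (Suc (fst (prod_decode j))) / real (Suc (snd (prod_decode j)))"

definition ideal_ball :: "(nat \<Rightarrow> 'a::polish_space) \<Rightarrow> nat \<Rightarrow> 'a set" where
  "ideal_ball s k = ball (s (fst (prod_decode k))) (pos_rat (snd (prod_decode k)))"

text \<open>
  \<open>sigma_set s A n e\<close> is the \<open>\<Sigma>\<^sup>0\<^sub>n(A)\<close> set with index \<open>e\<close>. The hierarchy starts at level \<open>1\<close>;
  level \<open>0\<close> is left unspecified.
\<close>

fun sigma_set :: "(nat \<Rightarrow> 'a::polish_space) \<Rightarrow> nat set \<Rightarrow> nat \<Rightarrow> nat \<Rightarrow> 'a set" where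
  "sigma_set s A (Suc 0) e = (\<Union>i\<in>ce_set A e. ideal_ball s i)"
| "sigma_set s A (Suc (Suc n)) e = (\<Union>i\<in>ce_set A e. - sigma_set s A (Suc n) i)"

definition is_sigma :: "(nat \<Rightarrow> 'a::polish_space) \<Rightarrow> nat set \<Rightarrow> nat \<Rightarrow> 'a set \<Rightarrow> bool" where
  "is_sigma s A n U \<longleftrightarrow> (\<exists>e. U = sigma_set s A n e)"

definition is_pi :: "(nat \<Rightarrow> 'a::polish_space) \<Rightarrow> nat set \<Rightarrow> nat \<Rightarrow> 'a set \<Rightarrow> bool" where
  "is_pi s A n P \<longleftrightarrow> is_sigma s A n (- P)"


section \<open>Computable probability spaces, randomness and genericity\<close>

text \<open>Finite sets of natural numbers are given by their canonical indices \<^const>\<open>set_decode\<close>.\<close>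

definition computable_prob_space :: "(nat \<Rightarrow> 'a::polish_space) \<Rightarrow> 'a measure \<Rightarrow> bool" where
  "computable_prob_space s \<mu> \<longleftrightarrow>
     computable_metric_space s \<and> prob_space \<mu> \<and> sets \<mu> = sets borel \<and>
     uniformly lower_semicomputable_index
       (\<lambda>k. measure \<mu> (\<Union>i\<in>set_decode k. ideal_ball s i))"

definition schnorr_test ::
  "(nat \<Rightarrow> 'a::polish_space) \<Rightarrow> 'a measure \<Rightarrow> nat set \<Rightarrow> nat \<Rightarrow> (nat \<Rightarrow> 'a set) \<Rightarrow> bool" where
  "schnorr_test s \<mu> A n U \<longleftrightarrow>
     uniformly (\<lambda>e V. V = sigma_set s A n e) U \<and>
     (\<forall>k. measure \<mu> (U k) \<le> 1 / 2 ^ k) \<and>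
     uniformly (computable_real_index ((turing_jump ^^ (n - 1)) A)) (\<lambda>k. measure \<mu> (U k))"

definition schnorr_random ::
  "(nat \<Rightarrow> 'a::polish_space) \<Rightarrow> 'a measure \<Rightarrow> nat set \<Rightarrow> nat \<Rightarrow> 'a \<Rightarrow> bool" where
  "schnorr_random s \<mu> A n x \<longleftrightarrow> (\<forall>U. schnorr_test s \<mu> A n U \<longrightarrow> x \<notin> (\<Inter>k. U k))"

definition weakly_quasi_pi_generic ::
  "(nat \<Rightarrow> 'a::polish_space) \<Rightarrow> 'a measure \<Rightarrow> nat set \<Rightarrow> nat \<Rightarrow> 'a \<Rightarrow> bool" where
  "weakly_quasi_pi_generic s \<mu> A n x \<longleftrightarrow>
     (\<forall>P. is_pi s A n P \<and> x \<in> P \<longrightarrow>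
        (\<exists>Q. is_pi s ((turing_jump ^^ (n - 1)) A) 1 Q \<and> Q \<subseteq> P \<and>
             measure \<mu> Q > 0 \<and> computable_real ((turing_jump ^^ (n - 1)) A) (measure \<mu> Q)))"


section \<open>Partial measure-preserving transformations\<close>

text \<open>
  A partial map is given by its domain \<open>D\<close> and a function \<open>T\<close> whose values outside \<open>D\<close> are
  irrelevant; the preimage of \<open>B\<close> is \<open>T -` B \<inter> D\<close>.
\<close>

definition measure_preserving_map ::
  "'a::polish_space measure \<Rightarrow> 'a set \<Rightarrow> ('a \<Rightarrow> 'a) \<Rightarrow> bool" where
  "measure_preserving_map \<mu> D T \<longleftrightarrow>
     (\<forall>B\<in>sets borel. T -` B \<inter> D \<in> sets borel \<and> measure \<mu> (T -` B \<inter> D) = measure \<mu> B) \<and>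
     T ` D \<subseteq> D"

definition computable_map ::
  "(nat \<Rightarrow> 'a::polish_space) \<Rightarrow> 'a set \<Rightarrow> ('a \<Rightarrow> 'a) \<Rightarrow> bool" where
  "computable_map s D T \<longleftrightarrow>
     uniformly (\<lambda>e V. V = D \<inter> sigma_set s {} 1 e) (\<lambda>i. T -` ideal_ball s i \<inter> D)"

definition ergodic_map ::
  "'a::polish_space measure \<Rightarrow> 'a set \<Rightarrow> ('a \<Rightarrow> 'a) \<Rightarrow> bool" where
  "ergodic_map \<mu> D T \<longleftrightarrow>
     (\<forall>B\<in>sets borel. T -` B \<inter> D = B \<longrightarrow> measure \<mu> B = 0 \<or> measure \<mu> B = 1)"

end

theory Submission
  imports Defs
begin

text \<open>
  Let \<open>B\<close> be the \<open>(n - 1)\<close>-th jump of \<open>A\<close>. Every \<open>\<Sigma>\<^sup>0\<^sub>1(B)\<close> set is uniformly \<open>\<Sigma>\<^sup>0\<^sub>n(A)\<close>, so \<open>x\<close> passes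
  every Schnorr \<open>1\<close>-test relative to \<open>B\<close>. Genericity gives a \<open>\<Pi>\<^sup>0\<^sub>1(B)\<close> set \<open>Q \<subseteq> P\<close> of positive
  \<open>B\<close>-computable measure. Let \<open>U\<close> be its complement, \<open>V\<^sub>0 = X\<close>, and let \<open>V\<^sub>m\<^sub>+\<^sub>1\<close> be open and agree
  on \<open>dom T\<close> with the preimage of \<open>U \<inter> V\<^sub>m\<close>; then \<open>V\<^sub>m\<close> consists of the points whose iterates \<open>1, \<dots>, m\<close>
  avoid \<open>Q\<close>. By invariance of the measure
  \<open>\<mu>(V\<^sub>m) + (\<Sum>j<m. \<mu>(U \<union> V\<^sub>j)) + m \<mu>(Q) = m + 1\<close>, and as the measures of \<open>\<Sigma>\<^sup>0\<^sub>1(B)\<close> sets are lower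
  semicomputable, \<open>\<mu>(V\<^sub>m)\<close> is \<open>B\<close>-computable. It tends to \<open>0\<close> by ergodicity, so a subsequence of the
  \<open>V\<^sub>m\<close> is a Schnorr test, and \<open>x\<close> would lie in all of them if its orbit avoided \<open>Q\<close>.
\<close>

section \<open>Relative computability\<close>

text \<open>The measure of \<open>P\<close> need not be computable in the jump \<open>B\<close>, and
  this is why genericity is applied before the test is built. The set \<open>Q\<close> need not
  contain \<open>x\<close>: an orbit avoiding \<open>P\<close> avoids every subset of
  \<open>P\<close>. The main obstacle is the measure of an intersection of open sets, for which only
  lower bounds can be enumerated. Inclusion-exclusion turns it into mu(U) + mu(V) - mu(U \<union>
  V), and the subtracted term would need upper bounds. Moving the unions to the other side and
  telescoping leaves a sum of quantities that all have lower approximations and whose total is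
  known; once the lower bounds nearly exhaust the total, each of them is accurate. The domain of
  \<open>T\<close> is known only to be a Borel set of full measure, so the construction takes place
  on indices of open subsets of the whole space, which are controlled only inside the domain. The
  machine model is developed as far as a stagewise universal program, because the passage from the
  jump back to \<open>A\<close> needs the fact that a halting computation uses a bounded part of its
  oracle.\<close>

abbreviation pfst :: "nat \<Rightarrow> nat" where "pfst z \<equiv> fst (prod_decode z)"
abbreviation psnd :: "nat \<Rightarrow> nat" where "psnd z \<equiv> snd (prod_decode z)"

lemma computes_deterministic:
  "computes A p x y \<Longrightarrow> computes A p x z \<Longrightarrow> z = y"
proof (induction arbitrary: z rule: computes.induct)
  case (9 p q x m y w)
  from "9.prems" show ?case
    by (cases rule: computes.cases) (use "9.IH" in auto)
next
  case (10 p x m)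
  from "10.prems" show ?case
  proof (cases rule: computes.cases)
    case 10
    \<comment> \<open>Of two different results of the search, the larger requires a positive value
      at the smaller, where the value is 0.\<close>
    then show ?thesis
      using "10.IH" by (metis less_irrefl linorder_neqE_nat)
  qed
next
  case (1 x)
  from "1.prems" show ?case by (cases rule: computes.cases) auto
next
  case (2 x)
  from "2.prems" show ?case by (cases rule: computes.cases) auto
next
  case (3 x)
  from "3.prems" show ?case by (cases rule: computes.cases) auto
next
  case (4 x)
  from "4.prems" show ?case by (cases rule: computes.cases) auto
next
  case (5 x)
  from "5.prems" show ?case by (cases rule: computes.cases) auto
next
  case (6 p x y q z w)
  from "6.prems" show ?case by (cases rule: computes.cases) (use "6.IH" in auto)
next
  case (7 q x y p z w)
  from "7.prems" show ?case by (cases rule: computes.cases) (use "7.IH" in blast)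
next
  case (8 p x y q w)
  from "8.prems" show ?case by (cases rule: computes.cases) (use "8.IH" in auto)
qed

text \<open>Programs are hidden behind existential quantifiers, so that the closure lemmas below
  decompose a lambda term by \<open>intro\<close> without naming programs. Several arguments are
  passed as nested Cantor pairs.\<close>

definition rec_in :: "nat set \<Rightarrow> (nat \<Rightarrow> nat) \<Rightarrow> bool" where
  "rec_in A f \<longleftrightarrow> (\<exists>p. \<forall>x. computes A p x (f x))"

definition dec_in :: "nat set \<Rightarrow> (nat \<Rightarrow> bool) \<Rightarrow> bool" where
  "dec_in A P \<longleftrightarrow> rec_in A (\<lambda>x. of_bool (P x))"

definition ce_in :: "nat set \<Rightarrow> (nat \<Rightarrow> bool) \<Rightarrow> bool" where
  "ce_in A P \<longleftrightarrow> (\<exists>p. \<forall>x. P x \<longleftrightarrow> (\<exists>y. computes A p x y))"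

lemma computable_fun_iff_rec_in: "computable_fun f \<longleftrightarrow> rec_in {} f"
  by (simp add: computable_fun_def rec_in_def)

lemma rec_in_id: "rec_in A (\<lambda>x. x)"
proof -
  have "computes A (Tuple Fst Snd) x x" for x
    using computes.intros(6)[OF computes.intros(3,4), of A x] by simp
  then show ?thesis unfolding rec_in_def by blast
qed

lemma rec_in_compose:
  assumes "rec_in A f" "rec_in A g" shows "rec_in A (\<lambda>x. f (g x))"
  using assms unfolding rec_in_def by (meson computes.intros(7))

lemma rec_in_const: "rec_in A (\<lambda>x. c)"
proof (induction c)
  case 0 then show ?case unfolding rec_in_def by (meson computes.intros(1))
next
  case (Suc c)
  then show ?case unfolding rec_in_def by (meson computes.intros(2,7))
qed

lemma rec_in_Suc: "rec_in A f \<Longrightarrow> rec_in A (\<lambda>x. Suc (f x))"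
  unfolding rec_in_def by (meson computes.intros(2,7))

lemma rec_in_fst: "rec_in A f \<Longrightarrow> rec_in A (\<lambda>x. pfst (f x))"
  unfolding rec_in_def by (meson computes.intros(3,7))

lemma rec_in_snd: "rec_in A f \<Longrightarrow> rec_in A (\<lambda>x. psnd (f x))"
  unfolding rec_in_def by (meson computes.intros(4,7))

lemma rec_in_pair: "rec_in A f \<Longrightarrow> rec_in A g \<Longrightarrow> rec_in A (\<lambda>x. prod_encode (f x, g x))"
  unfolding rec_in_def by (meson computes.intros(6))

lemma computes_Query: "computes A Query x (of_bool (x \<in> A))"
  using computes.intros(5)[of A x] by (simp add: of_bool_def)

lemma dec_in_oracle: "dec_in A (\<lambda>x. x \<in> A)"
  unfolding rec_in_def dec_in_def using computes_Query by blast

lemma rec_in_apply2: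
  assumes "rec_in A (\<lambda>z. h (pfst z) (psnd z))" "rec_in A f" "rec_in A g"
  shows "rec_in A (\<lambda>x. h (f x) (g x))"
  using rec_in_compose[OF assms(1) rec_in_pair[OF assms(2,3)]] by simp

text \<open>The hypothesis on \<open>h\<close> reads its input as (x, (m, y)), the format in which
  \<open>Prim\<close> passes the parameter, the counter and the previous value.\<close>

lemma rec_in_rec:
  assumes "rec_in A g" "rec_in A (\<lambda>z. h (pfst z) (pfst (psnd z)) (psnd (psnd z)))" "rec_in A b"
  shows "rec_in A (\<lambda>x. rec_nat (g x) (h x) (b x))"
proof -
  obtain p q where p: "\<And>x. computes A p x (g x)"
    and q: "\<And>z. computes A q z (h (pfst z) (pfst (psnd z)) (psnd (psnd z)))"
    using assms unfolding rec_in_def by blast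
  have "computes A (Prim p q) (prod_encode (x, m)) (rec_nat (g x) (h x) m)" for x m
  proof (induction m)
    case 0 then show ?case by (simp add: computes.intros(8) p)
  next
    case (Suc m)
    from computes.intros(9)[OF Suc] q[of "prod_encode (x, prod_encode (m, rec_nat (g x) (h x) m))"]
    show ?case by simp
  qed
  then have "\<forall>z. computes A (Prim p q) z (rec_nat (g (pfst z)) (h (pfst z)) (psnd z))"
    by (metis prod.collapse prod_decode_inverse)
  then have "rec_in A (\<lambda>z. rec_nat (g (pfst z)) (h (pfst z)) (psnd z))"
    unfolding rec_in_def by blast
  from rec_in_apply2[OF this rec_in_id assms(3)] show ?thesis .
qed

lemma rec_in_add:
  assumes "rec_in A f" "rec_in A g" shows "rec_in A (\<lambda>x. f x + g x)"
proof -
  have "rec_in A (\<lambda>x. rec_nat (f x) (\<lambda>_ y. Suc y) (g x))"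
    by (intro rec_in_rec rec_in_Suc rec_in_snd rec_in_id assms)
  moreover have "rec_nat a (\<lambda>_ y. Suc y) b = a + b" for a b by (induction b) auto
  ultimately show ?thesis by simp
qed

lemma rec_in_pred:
  assumes "rec_in A f" shows "rec_in A (\<lambda>x. f x - 1)"
proof -
  have "rec_in A (\<lambda>x. rec_nat 0 (\<lambda>m y. m) (f x))"
    by (intro rec_in_rec rec_in_fst rec_in_snd rec_in_id rec_in_const assms)
  moreover have "rec_nat 0 (\<lambda>m y. m) b = b - 1" for b by (induction b) auto
  ultimately show ?thesis by simp
qed

lemma rec_in_diff:
  assumes "rec_in A f" "rec_in A g" shows "rec_in A (\<lambda>x. f x - g x)"
proof -
  have "rec_in A (\<lambda>x. rec_nat (f x) (\<lambda>_ y. y - 1) (g x))"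
    by (intro rec_in_rec rec_in_pred rec_in_snd rec_in_id assms)
  moreover have "rec_nat a (\<lambda>_ y. y - 1) b = a - b" for a b :: nat by (induction b) auto
  ultimately show ?thesis by simp
qed

lemma rec_in_mult:
  assumes "rec_in A f" "rec_in A g" shows "rec_in A (\<lambda>x. f x * g x)"
proof -
  have "rec_in A (\<lambda>x. rec_nat 0 (\<lambda>_ y. f x + y) (g x))"
    by (intro rec_in_rec rec_in_add rec_in_snd rec_in_id rec_in_const rec_in_compose[OF assms(1)] rec_in_fst assms)
  moreover have "rec_nat 0 (\<lambda>_ y. a + y) b = a * b" for a b :: nat by (induction b) auto
  ultimately show ?thesis by simp
qed

lemma rec_in_power:
  assumes "rec_in A f" "rec_in A g" shows "rec_in A (\<lambda>x. f x ^ g x)"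
proof -
  have "rec_in A (\<lambda>x. rec_nat 1 (\<lambda>_ y. f x * y) (g x))"
    by (intro rec_in_rec rec_in_mult rec_in_snd rec_in_id rec_in_const rec_in_compose[OF assms(1)] rec_in_fst assms)
  moreover have "rec_nat 1 (\<lambda>_ y. a * y) b = a ^ b" for a b :: nat by (induction b) auto
  ultimately show ?thesis by simp
qed

lemma rec_in_sum:
  assumes "rec_in A b" "rec_in A (\<lambda>z. F (pfst z) (psnd z))"
  shows "rec_in A (\<lambda>x. \<Sum>i<b x. F x i)"
proof -
  have "rec_in A (\<lambda>x. rec_nat 0 (\<lambda>m y. F x m + y) (b x))"
    by (intro rec_in_rec rec_in_add rec_in_snd rec_in_id rec_in_const rec_in_apply2[OF assms(2)] rec_in_fst assms)
  moreover have "rec_nat 0 (\<lambda>m y. f m + y) n = (\<Sum>i<n. f i)" for f :: "nat \<Rightarrow> nat" and n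
    by (induction n) auto
  ultimately show ?thesis by simp
qed

lemma dec_in_const: "dec_in A (\<lambda>x. c)"
  unfolding dec_in_def by (rule rec_in_const)

lemma dec_in_not:
  assumes "dec_in A P" shows "dec_in A (\<lambda>x. \<not> P x)"
proof -
  have "rec_in A (\<lambda>x. 1 - of_bool (P x))"
    by (intro rec_in_diff rec_in_const assms[unfolded dec_in_def])
  moreover have "1 - of_bool Q = (of_bool (\<not> Q) :: nat)" for Q by simp
  ultimately show ?thesis unfolding dec_in_def by simp
qed

lemma dec_in_conj: "dec_in A P \<Longrightarrow> dec_in A Q \<Longrightarrow> dec_in A (\<lambda>x. P x \<and> Q x)"
  unfolding dec_in_def of_bool_conj by (rule rec_in_mult)

lemma dec_in_disj: 
  assumes "dec_in A P" "dec_in A Q" shows "dec_in A (\<lambda>x. P x \<or> Q x)"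
  using dec_in_not[OF dec_in_conj[OF dec_in_not[OF assms(1)] dec_in_not[OF assms(2)]]] by simp

lemma dec_in_imp: 
  assumes "dec_in A P" "dec_in A Q" shows "dec_in A (\<lambda>x. P x \<longrightarrow> Q x)"
  unfolding imp_conv_disj by (intro dec_in_disj dec_in_not assms)

lemma dec_in_le:
  assumes "rec_in A f" "rec_in A g" shows "dec_in A (\<lambda>x. f x \<le> g x)"
proof -
  have "rec_in A (\<lambda>x. 1 - (f x - g x))"
    by (intro rec_in_diff rec_in_const assms)
  moreover have "1 - (a - b) = (of_bool (a \<le> b) :: nat)" for a b :: nat by auto
  ultimately show ?thesis unfolding dec_in_def by simp
qed

lemma dec_in_less:
  assumes "rec_in A f" "rec_in A g" shows "dec_in A (\<lambda>x. f x < g x)"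
  using dec_in_not[OF dec_in_le[OF assms(2,1)]] by (simp add: not_le)

lemma dec_in_eq:
  assumes "rec_in A f" "rec_in A g" shows "dec_in A (\<lambda>x. f x = g x)"
  using dec_in_conj[OF dec_in_le[OF assms] dec_in_le[OF assms(2,1)]] by (simp add: order_eq_iff)

lemma dec_in_ex_less:
  assumes "rec_in A b" "dec_in A (\<lambda>z. P (pfst z) (psnd z))"
  shows "dec_in A (\<lambda>x. \<exists>i<b x. P x i)"
proof -
  have "dec_in A (\<lambda>x. 0 < (\<Sum>i<b x. of_bool (P x i) :: nat))"
    by (intro dec_in_less rec_in_sum rec_in_const assms assms(2)[unfolded dec_in_def])
  moreover have "0 < (\<Sum>i<n. of_bool (Q i) :: nat) \<longleftrightarrow> (\<exists>i<n. Q i)" for Q and n :: nat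
    by (auto simp: card_gt_0_iff)
  ultimately show ?thesis by simp
qed

lemma dec_in_all_less:
  assumes "rec_in A b" "dec_in A (\<lambda>z. P (pfst z) (psnd z))"
  shows "dec_in A (\<lambda>x. \<forall>i<b x. P x i)"
  using dec_in_not[OF dec_in_ex_less[OF assms(1) dec_in_not[OF assms(2)]]] by simp

lemma rec_in_if:
  assumes "dec_in A P" "rec_in A f" "rec_in A g"
  shows "rec_in A (\<lambda>x. if P x then f x else g x)"
proof -
  have "rec_in A (\<lambda>x. of_bool (P x) * f x + of_bool (\<not> P x) * g x)"
    by (intro rec_in_add rec_in_mult assms dec_in_not[OF assms(1), unfolded dec_in_def] assms[unfolded dec_in_def])
  moreover have "of_bool Q * a + of_bool (\<not> Q) * b = (if Q then a else b)" for Q and a b :: nat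
    by simp
  ultimately show ?thesis by simp
qed

lemma rec_in_of_bool: "dec_in A P \<Longrightarrow> rec_in A (\<lambda>x. of_bool (P x))"
  by (simp add: dec_in_def)

lemma rec_in_div:
  assumes "rec_in A f" "rec_in A g" shows "rec_in A (\<lambda>x. f x div g x)"
proof -
  \<comment> \<open>The quotient counts the positive multiples of the divisor up to the dividend. A
    zero divisor is split off because every \<open>i\<close> would then be counted.\<close>
  have "rec_in A (\<lambda>x. if g x = 0 then 0 else \<Sum>i<f x. of_bool (Suc i * g x \<le> f x))"
    by (intro rec_in_if dec_in_eq rec_in_const rec_in_sum rec_in_of_bool dec_in_le rec_in_mult rec_in_Suc rec_in_snd rec_in_fst
          rec_in_id assms rec_in_compose[OF assms(1)] rec_in_compose[OF assms(2)])
  moreover have "(\<Sum>i<a. of_bool (Suc i * b \<le> a)) = a div b" if "b \<noteq> 0" for a b :: nat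
  proof -
    have "{i. i < a \<and> Suc i * b \<le> a} = {..<a div b}"
    proof (intro set_eqI iffI)
      fix i assume "i \<in> {i. i < a \<and> Suc i * b \<le> a}"
      then have "Suc i \<le> a div b" using that less_eq_div_iff_mult_less_eq[of b "Suc i" a] by simp
      then show "i \<in> {..<a div b}" by simp
    next
      fix i assume "i \<in> {..<a div b}"
      then have "Suc i \<le> a div b" by simp
      then show "i \<in> {i. i < a \<and> Suc i * b \<le> a}"
        using that less_eq_div_iff_mult_less_eq[of b "Suc i" a]
          less_le_trans[of i "a div b" a, OF _ div_le_dividend] by simp
    qed
    then show ?thesis by (simp add: of_bool_def sum.If_cases lessThan_def Collect_conj_eq[symmetric])
  qed
  ultimately have "rec_in A (\<lambda>x. if g x = 0 then 0 else f x div g x)"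
    by (simp cong: if_cong)
  moreover have "(if b = 0 then 0 else a div b) = a div b" for a b :: nat by simp
  ultimately show ?thesis by simp
qed

lemma rec_in_mod:
  assumes "rec_in A f" "rec_in A g" shows "rec_in A (\<lambda>x. f x mod g x)"
  unfolding minus_div_mult_eq_mod[symmetric] by (intro rec_in_diff rec_in_mult rec_in_div assms)

lemma dec_in_compose: "dec_in A P \<Longrightarrow> rec_in A f \<Longrightarrow> dec_in A (\<lambda>x. P (f x))"
  unfolding dec_in_def by (rule rec_in_compose)

lemma dec_in_apply2:
  "dec_in A (\<lambda>z. P (pfst z) (psnd z)) \<Longrightarrow> rec_in A f \<Longrightarrow> rec_in A g \<Longrightarrow> dec_in A (\<lambda>x. P (f x) (g x))"
  unfolding dec_in_def by (rule rec_in_apply2)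

lemma dec_in_even: "rec_in A f \<Longrightarrow> dec_in A (\<lambda>x. even (f x))"
  unfolding even_iff_mod_2_eq_zero by (intro dec_in_eq rec_in_mod rec_in_const)

lemma dec_in_set_decode:
  "rec_in A f \<Longrightarrow> rec_in A g \<Longrightarrow> dec_in A (\<lambda>x. f x \<in> set_decode (g x))"
  unfolding set_decode_def by (auto intro!: dec_in_not dec_in_even rec_in_div rec_in_power rec_in_const)

lemma rec_in_search:
  assumes "dec_in A (\<lambda>z. P (pfst z) (psnd z))" "\<And>x. \<exists>i. P x i"
  shows "\<exists>g. rec_in A g \<and> (\<forall>x. P x (g x))"
proof -
  \<comment> \<open>The predicate is negated because \<open>Mu\<close> searches for the value
    0.\<close>
  obtain p where p: "\<And>z. computes A p z (of_bool (\<not> P (pfst z) (psnd z)))"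
    using dec_in_not[OF assms(1)] unfolding dec_in_def rec_in_def by blast
  define g where "g x = (LEAST i. P x i)" for x
  have g: "P x (g x)" for x unfolding g_def using assms(2) by (rule LeastI_ex)
  have "computes A (Mu p) x (g x)" for x
  proof (rule computes.intros(10))
    show "computes A p (prod_encode (x, g x)) 0"
      using p[of "prod_encode (x, g x)"] g by simp
    have "computes A p (prod_encode (x, l)) 1" if "l < g x" for l
      using p[of "prod_encode (x, l)"] not_less_Least[of l "P x"] that by (simp add: g_def)
    then show "\<forall>l<g x. \<exists>y>0. computes A p (prod_encode (x, l)) y"
      by (metis zero_less_one)
  qed
  then show ?thesis using g unfolding rec_in_def by blast
qed

lemmas rec_in_intros = rec_in_id rec_in_const rec_in_Suc rec_in_fst rec_in_snd rec_in_pair rec_in_add rec_in_diff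
  rec_in_mult rec_in_power rec_in_sum rec_in_if rec_in_of_bool rec_in_div rec_in_mod
lemmas dec_in_intros = dec_in_const dec_in_not dec_in_conj dec_in_disj dec_in_imp dec_in_le dec_in_less dec_in_eq dec_in_ex_less
  dec_in_all_less dec_in_even dec_in_set_decode

section \<open>A universal program\<close>

text \<open>The offsets 5, 6, 7, 8 are 5 + r for the residues r = 0, 1, 2, 3 that select the
  constructor. The closed forms make it possible to compute with indices.\<close>

lemma program_of_simps:
  "program_of 0 = Zero" "program_of (Suc 0) = Succ" "program_of 2 = Fst" "program_of 3 = Snd"
  "program_of 4 = Query"
  "program_of (5 + 4 * prod_encode (a, b)) = Tuple (program_of a) (program_of b)"
  "program_of (6 + 4 * prod_encode (a, b)) = Comp (program_of a) (program_of b)"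
  "program_of (7 + 4 * prod_encode (a, b)) = Prim (program_of a) (program_of b)"
  "program_of (8 + 4 * k) = Mu (program_of k)"
proof -
  have *: "(5 + r + 4 * k - 5) div 4 = k" "(5 + r + 4 * k - 5) mod 4 = r" if "r < 4" for r k :: nat
    using that by auto
  show "program_of 0 = Zero" "program_of (Suc 0) = Succ" "program_of 2 = Fst" "program_of 3 = Snd"
    "program_of 4 = Query" by (subst program_of.simps; simp)+
  show "program_of (5 + 4 * prod_encode (a, b)) = Tuple (program_of a) (program_of b)"
    using *[of 0 "prod_encode (a, b)"] by (subst program_of.simps) (simp add: Let_def)
  show "program_of (6 + 4 * prod_encode (a, b)) = Comp (program_of a) (program_of b)"
    using *[of 1 "prod_encode (a, b)"] by (subst program_of.simps) (simp add: Let_def)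
  show "program_of (7 + 4 * prod_encode (a, b)) = Prim (program_of a) (program_of b)"
    using *[of 2 "prod_encode (a, b)"] by (subst program_of.simps) (simp add: Let_def)
  show "program_of (8 + 4 * k) = Mu (program_of k)"
    using *[of 3 k] by (subst program_of.simps) (simp add: Let_def)
qed

lemma program_index_cases:
  obtains "e = 0" | "e = 1" | "e = 2" | "e = 3" | "e = 4"
  | a b where "e = 5 + 4 * prod_encode (a, b)" | a b where "e = 6 + 4 * prod_encode (a, b)"
  | a b where "e = 7 + 4 * prod_encode (a, b)" | k where "e = 8 + 4 * k"
proof -
  define k where "k = (e - 5) div 4"
  have "e < 5 \<or> e = 5 + 4 * k \<or> e = 6 + 4 * k \<or> e = 7 + 4 * k \<or> e = 8 + 4 * k"
    unfolding k_def by linarith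
  moreover have "prod_encode (pfst k, psnd k) = k" by simp
  moreover have "e < 5 \<Longrightarrow> e = 0 \<or> e = 1 \<or> e = 2 \<or> e = 3 \<or> e = 4" by linarith
  ultimately show ?thesis using that by metis
qed

text \<open>Inversion of the numbering: induction on a computation yields programs, whereas the
  stages below store indices, so the indices of the subprograms must be recovered.\<close>

lemma program_of_eqD:
  "program_of e = Zero \<Longrightarrow> e = 0"
  "program_of e = Succ \<Longrightarrow> e = 1"
  "program_of e = Fst \<Longrightarrow> e = 2"
  "program_of e = Snd \<Longrightarrow> e = 3"
  "program_of e = Query \<Longrightarrow> e = 4"
  "program_of e = Tuple p q \<Longrightarrow>
    \<exists>a b. e = 5 + 4 * prod_encode (a, b) \<and> program_of a = p \<and> program_of b = q"
  "program_of e = Comp p q \<Longrightarrow>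
    \<exists>a b. e = 6 + 4 * prod_encode (a, b) \<and> program_of a = p \<and> program_of b = q"
  "program_of e = Prim p q \<Longrightarrow>
    \<exists>a b. e = 7 + 4 * prod_encode (a, b) \<and> program_of a = p \<and> program_of b = q"
  "program_of e = Mu p \<Longrightarrow> \<exists>k. e = 8 + 4 * k \<and> program_of k = p"
  by (rule program_index_cases[of e]; simp add: program_of_simps)+

lemma program_of_surj: "\<exists>e. program_of e = p"
  by (induction p) (metis program_of_simps)+

definition triple :: "nat \<Rightarrow> nat \<Rightarrow> nat \<Rightarrow> nat" where
  "triple e x y = prod_encode (e, prod_encode (x, y))"

text \<open>
  The rules of \<^const>\<open>computes\<close>, with recursive calls looked up in the finite set with canonical
  index \<open>d\<close> and existential witnesses bounded by \<open>t\<close>. Iterating them only needs bounded quantifiers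
  and arithmetic, which makes every stage computable in the oracle.
\<close>

definition clause :: "(nat \<Rightarrow> bool) \<Rightarrow> nat \<Rightarrow> nat \<Rightarrow> nat \<Rightarrow> nat \<Rightarrow> nat \<Rightarrow> bool" where
  "clause Or t d e x y \<longleftrightarrow>
    (e = 0 \<and> y = 0) \<or> (e = 1 \<and> y = Suc x) \<or> (e = 2 \<and> y = pfst x) \<or> (e = 3 \<and> y = psnd x) \<or>
    (e = 4 \<and> y = of_bool (Or x)) \<or>
    (\<exists>k<e. 
      (e = 5 + 4 * k \<and> triple (pfst k) x (pfst y) \<in> set_decode d \<and>
         triple (psnd k) x (psnd y) \<in> set_decode d) \<or>
      (e = 6 + 4 * k \<and> (\<exists>u<t. triple (psnd k) x u \<in> set_decode d \<and>
         triple (pfst k) u y \<in> set_decode d)) \<or>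
      (e = 7 + 4 * k \<and> psnd x = 0 \<and> triple (pfst k) (pfst x) y \<in> set_decode d) \<or>
      (e = 7 + 4 * k \<and> psnd x \<noteq> 0 \<and>
         (\<exists>u<t. triple e (prod_encode (pfst x, psnd x - 1)) u \<in> set_decode d \<and>
            triple (psnd k) (prod_encode (pfst x, prod_encode (psnd x - 1, u))) y \<in> set_decode d)) \<or>
      (e = 8 + 4 * k \<and> triple k (prod_encode (x, y)) 0 \<in> set_decode d \<and>
         (\<forall>l<y. \<exists>u<t. 0 < u \<and> triple k (prod_encode (x, l)) u \<in> set_decode d)))"

text \<open>The bound \<open>z < t\<close> makes each stage finite, hence codable by one number, and
  limits the oracle queries made up to that stage. The oracle is a predicate argument so that
  approximations to it can be substituted later.\<close>

primrec stage :: "(nat \<Rightarrow> bool) \<Rightarrow> nat \<Rightarrow> nat" where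
  "stage Or 0 = 0"
| "stage Or (Suc t) = set_encode {z. z < t \<and> clause Or t (stage Or t) (pfst z) (pfst (psnd z)) (psnd (psnd z))}"

lemma set_decode_stage_Suc:
  "set_decode (stage Or (Suc t)) =
    {z. z < t \<and> clause Or t (stage Or t) (pfst z) (pfst (psnd z)) (psnd (psnd z))}"
  by (simp add: set_encode_inverse)

lemma triple_inject [simp]:
  "pfst (triple e x y) = e" "pfst (psnd (triple e x y)) = x" "psnd (psnd (triple e x y)) = y"
  by (auto simp: triple_def)

text \<open>Both the table and the bound occur only positively: the bound \<open>t\<close> restricts
  existential quantifiers only, and table membership is never negated.\<close>

lemma clause_mono:
  assumes "clause Or t d e x y" "t \<le> t'" "set_decode d \<subseteq> set_decode d'"
  shows "clause Or t' d' e x y"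
proof -
  have "u < t'" if "u < t" for u using that assms(2) by simp
  with subsetD[OF assms(3)] show ?thesis
    using assms(1) unfolding clause_def
    by (elim disj_forward ex_forward conj_forward all_forward imp_forward; assumption?) simp_all
qed

lemma stage_mono: "t \<le> t' \<Longrightarrow> set_decode (stage Or t) \<subseteq> set_decode (stage Or t')"
proof -
  have "set_decode (stage Or t) \<subseteq> set_decode (stage Or (Suc t))" for t
  proof (induction t)
    case 0 then show ?case by simp
  next
    case (Suc t)
    show ?case
    proof
      fix z assume "z \<in> set_decode (stage Or (Suc t))"
      then have "z < Suc t" "clause Or t (stage Or t) (pfst z) (pfst (psnd z)) (psnd (psnd z))"
        unfolding set_decode_stage_Suc by auto
      then show "z \<in> set_decode (stage Or (Suc (Suc t)))"
        unfolding set_decode_stage_Suc[of Or "Suc t"] using clause_mono[OF _ _ Suc] by auto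
    qed
  qed
  then show "t \<le> t' \<Longrightarrow> ?thesis" by (rule lift_Suc_mono_le)
qed

lemma stage_sound:
  "triple e x y \<in> set_decode (stage (\<lambda>i. i \<in> A) t) \<Longrightarrow> computes A (program_of e) x y"
proof (induction t arbitrary: e x y)
  case 0 then show ?case by simp
next
  case (Suc t)
  let ?c = "computes A"
  from Suc.prems have "clause (\<lambda>i. i \<in> A) t (stage (\<lambda>i. i \<in> A) t) e x y"
    unfolding set_decode_stage_Suc by simp
  then show ?case
    unfolding clause_def
  proof (elim disjE exE conjE)
    fix k assume *: "e = 5 + 4 * k" "triple (pfst k) x (pfst y) \<in> set_decode (stage (\<lambda>i. i \<in> A) t)"
      "triple (psnd k) x (psnd y) \<in> set_decode (stage (\<lambda>i. i \<in> A) t)"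
    have e: "program_of e = Tuple (program_of (pfst k)) (program_of (psnd k))"
      using program_of_simps(6)[of "pfst k" "psnd k"] *(1) by simp
    have "computes A (program_of e) x (prod_encode (pfst y, psnd y))"
      unfolding e using *(2,3)[THEN Suc.IH] by (rule computes.intros)
    then show ?thesis by simp
  next
    fix k u assume *: "e = 6 + 4 * k" "triple (psnd k) x u \<in> set_decode (stage (\<lambda>i. i \<in> A) t)"
      "triple (pfst k) u y \<in> set_decode (stage (\<lambda>i. i \<in> A) t)"
    have e: "program_of e = Comp (program_of (pfst k)) (program_of (psnd k))"
      using program_of_simps(7)[of "pfst k" "psnd k"] *(1) by simp
    show ?thesis
      unfolding e using *(2,3)[THEN Suc.IH] by (rule computes.intros)
  next
    fix k assume *: "e = 7 + 4 * k" "psnd x = 0"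
      "triple (pfst k) (pfst x) y \<in> set_decode (stage (\<lambda>i. i \<in> A) t)"
    have e: "program_of e = Prim (program_of (pfst k)) (program_of (psnd k))"
      using program_of_simps(8)[of "pfst k" "psnd k"] *(1) by simp
    have "computes A (program_of e) (prod_encode (pfst x, 0)) y"
      unfolding e using *(3)[THEN Suc.IH] by (rule computes.intros)
    moreover have "prod_encode (pfst x, 0) = x"
      using *(2) by (metis prod.collapse prod_decode_inverse)
    ultimately show ?thesis by simp
  next
    fix k u assume *: "e = 7 + 4 * k" "psnd x \<noteq> 0"
      "triple e (prod_encode (pfst x, psnd x - 1)) u \<in> set_decode (stage (\<lambda>i. i \<in> A) t)"
      "triple (psnd k) (prod_encode (pfst x, prod_encode (psnd x - 1, u))) y
         \<in> set_decode (stage (\<lambda>i. i \<in> A) t)"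
    have e: "program_of e = Prim (program_of (pfst k)) (program_of (psnd k))"
      using program_of_simps(8)[of "pfst k" "psnd k"] *(1) by simp
    have "x = prod_encode (pfst x, Suc (psnd x - 1))"
      using *(2) by simp
    then show ?thesis
      using computes.intros(9) Suc.IH[OF *(3)] Suc.IH[OF *(4)] unfolding e by metis
  next
    fix k assume *: "e = 8 + 4 * k" "triple k (prod_encode (x, y)) 0 \<in> set_decode (stage (\<lambda>i. i \<in> A) t)"
         "\<forall>l<y. \<exists>u<t. 0 < u \<and> triple k (prod_encode (x, l)) u \<in> set_decode (stage (\<lambda>i. i \<in> A) t)"
    show ?thesis
      unfolding *(1) program_of_simps using Suc.IH *(2,3) by (metis computes.intros(10))
  qed (use computes_Query in \<open>auto simp: program_of_simps intro: computes.intros\<close>)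
qed

lemma stage_ge:
  assumes "clause Or t (stage Or t) e x y"
  shows "\<exists>t. triple e x y \<in> set_decode (stage Or t)"
proof -
  define T where "T = max t (Suc (triple e x y))"
  have "clause Or T (stage Or T) e x y"
    by (rule clause_mono[OF assms]) (auto simp: T_def intro!: stage_mono)
  then have "triple e x y \<in> set_decode (stage Or (Suc T))"
    unfolding set_decode_stage_Suc by (simp add: T_def)
  then show ?thesis ..
qed

lemma clause_intros:
  "triple a x y \<in> set_decode d \<Longrightarrow> triple b x z \<in> set_decode d \<Longrightarrow>
    clause Or t d (5 + 4 * prod_encode (a, b)) x (prod_encode (y, z))"
  "triple b x y \<in> set_decode d \<Longrightarrow> triple a y z \<in> set_decode d \<Longrightarrow> y < t \<Longrightarrow>
    clause Or t d (6 + 4 * prod_encode (a, b)) x z"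
  "triple a x y \<in> set_decode d \<Longrightarrow>
    clause Or t d (7 + 4 * prod_encode (a, b)) (prod_encode (x, 0)) y"
  "triple (7 + 4 * prod_encode (a, b)) (prod_encode (x, m)) y \<in> set_decode d \<Longrightarrow>
    triple b (prod_encode (x, prod_encode (m, y))) z \<in> set_decode d \<Longrightarrow> y < t \<Longrightarrow>
    clause Or t d (7 + 4 * prod_encode (a, b)) (prod_encode (x, Suc m)) z"
  "triple k (prod_encode (x, m)) 0 \<in> set_decode d \<Longrightarrow>
    \<forall>l<m. \<exists>u<t. 0 < u \<and> triple k (prod_encode (x, l)) u \<in> set_decode d \<Longrightarrow>
    clause Or t d (8 + 4 * k) x m"
  subgoal unfolding clause_def by (intro disjI2 exI[of _ "prod_encode (a, b)"]) simp
  subgoal unfolding clause_def by (intro disjI2 exI[of _ "prod_encode (a, b)"]) (simp, blast)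
  subgoal unfolding clause_def by (intro disjI2 exI[of _ "prod_encode (a, b)"]) simp
  subgoal unfolding clause_def by (intro disjI2 exI[of _ "prod_encode (a, b)"]) (simp, blast)
  subgoal unfolding clause_def by (intro disjI2 exI[of _ k]) simp
  done

lemma stage_monoD: "z \<in> set_decode (stage Or t) \<Longrightarrow> t \<le> t' \<Longrightarrow> z \<in> set_decode (stage Or t')"
  using stage_mono by blast

text \<open>In each case the stages found for the premises are raised to a common one, which must
  also exceed the intermediate values, since those are sought below \<open>t\<close>.\<close>

lemma stage_complete:
  assumes "computes A p x y" "program_of e = p"
  shows "\<exists>t. triple e x y \<in> set_decode (stage (\<lambda>i. i \<in> A) t)"
  using assms
proof (induction arbitrary: e rule: computes.induct)
  case (6 p x y q z)
  obtain a b where e: "e = 5 + 4 * prod_encode (a, b)" "program_of a = p" "program_of b = q"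
    using program_of_eqD(6)[OF "6.prems"] by blast
  obtain t1 t2 where "triple a x y \<in> set_decode (stage (\<lambda>i. i \<in> A) t1)"
    "triple b x z \<in> set_decode (stage (\<lambda>i. i \<in> A) t2)"
    using "6.IH" e by blast
  then have "triple a x y \<in> set_decode (stage (\<lambda>i. i \<in> A) (max t1 t2))"
    "triple b x z \<in> set_decode (stage (\<lambda>i. i \<in> A) (max t1 t2))"
    by (auto elim: stage_monoD)
  then have "clause (\<lambda>i. i \<in> A) (max t1 t2) (stage (\<lambda>i. i \<in> A) (max t1 t2)) e x (prod_encode (y, z))"
    unfolding e(1) by (rule clause_intros)
  then show ?case by (rule stage_ge)
next
  case (7 q x y p z)
  obtain a b where e: "e = 6 + 4 * prod_encode (a, b)" "program_of a = p" "program_of b = q"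
    using program_of_eqD(7)[OF "7.prems"] by blast
  obtain t1 t2 where "triple b x y \<in> set_decode (stage (\<lambda>i. i \<in> A) t1)"
    "triple a y z \<in> set_decode (stage (\<lambda>i. i \<in> A) t2)"
    using "7.IH" e by blast
  moreover define t where "t = max (Suc y) (max t1 t2)"
  ultimately have "triple b x y \<in> set_decode (stage (\<lambda>i. i \<in> A) t)"
    "triple a y z \<in> set_decode (stage (\<lambda>i. i \<in> A) t)" "y < t"
    by (auto elim: stage_monoD)
  then have "clause (\<lambda>i. i \<in> A) t (stage (\<lambda>i. i \<in> A) t) e x z"
    unfolding e(1) by (rule clause_intros)
  then show ?case by (rule stage_ge)
next
  case (8 p x y q)
  obtain a b where e: "e = 7 + 4 * prod_encode (a, b)" "program_of a = p" "program_of b = q"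
    using program_of_eqD(8)[OF "8.prems"] by blast
  obtain t where "triple a x y \<in> set_decode (stage (\<lambda>i. i \<in> A) t)"
    using "8.IH" e by blast
  then have "clause (\<lambda>i. i \<in> A) t (stage (\<lambda>i. i \<in> A) t) e (prod_encode (x, 0)) y"
    unfolding e(1) by (rule clause_intros)
  then show ?case by (rule stage_ge)
next
  case (9 p q x m y z)
  obtain a b where e: "e = 7 + 4 * prod_encode (a, b)" "program_of a = p" "program_of b = q"
    using program_of_eqD(8)[OF "9.prems"] by blast
  obtain t1 t2 where "triple e (prod_encode (x, m)) y \<in> set_decode (stage (\<lambda>i. i \<in> A) t1)"
    "triple b (prod_encode (x, prod_encode (m, y))) z \<in> set_decode (stage (\<lambda>i. i \<in> A) t2)"
    using "9.IH" "9.prems" e by blast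
  moreover define t where "t = max (Suc y) (max t1 t2)"
  ultimately have "triple e (prod_encode (x, m)) y \<in> set_decode (stage (\<lambda>i. i \<in> A) t)"
    "triple b (prod_encode (x, prod_encode (m, y))) z \<in> set_decode (stage (\<lambda>i. i \<in> A) t)" "y < t"
    by (auto elim: stage_monoD)
  then have "clause (\<lambda>i. i \<in> A) t (stage (\<lambda>i. i \<in> A) t) e (prod_encode (x, Suc m)) z"
    unfolding e(1) by (rule clause_intros)
  then show ?case by (rule stage_ge)
next
  case (10 p x m)
  obtain k where e: "e = 8 + 4 * k" "program_of k = p"
    using program_of_eqD(9)[OF "10.prems"] by blast
  obtain t0 where t0: "triple k (prod_encode (x, m)) 0 \<in> set_decode (stage (\<lambda>i. i \<in> A) t0)"
    using "10.IH" e(2) by blast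
  have "\<forall>l<m. \<exists>y t. y > 0 \<and> triple k (prod_encode (x, l)) y \<in> set_decode (stage (\<lambda>i. i \<in> A) t)"
    using "10.IH" e(2) by metis
  then obtain Y T where YT: "\<And>l. l < m \<Longrightarrow> Y l > 0 \<and>
      triple k (prod_encode (x, l)) (Y l) \<in> set_decode (stage (\<lambda>i. i \<in> A) (T l))"
    by metis
  \<comment> \<open>A sum serves as a common upper bound for the finitely many values and stages;
    \<open>Suc\<close> gives the strict inequality \<open>Y l < t\<close>.\<close>
  define t where "t = t0 + (\<Sum>l<m. Suc (Y l) + T l)"
  have le: "Suc (Y l) + T l \<le> t" if "l < m" for l
    unfolding t_def using that by (intro trans_le_add2 member_le_sum) auto
  have "triple k (prod_encode (x, m)) 0 \<in> set_decode (stage (\<lambda>i. i \<in> A) t)"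
    using t0 by (rule stage_monoD) (simp add: t_def)
  moreover have "\<forall>l<m. \<exists>u<t. 0 < u \<and> triple k (prod_encode (x, l)) u \<in> set_decode (stage (\<lambda>i. i \<in> A) t)"
  proof (intro allI impI)
    fix l assume l: "l < m"
    have "Y l < t" "T l \<le> t" using le[OF l] by auto
    with YT[OF l]
    show "\<exists>u<t. 0 < u \<and> triple k (prod_encode (x, l)) u \<in> set_decode (stage (\<lambda>i. i \<in> A) t)"
      by (blast intro: stage_monoD)
  qed
  ultimately have "clause (\<lambda>i. i \<in> A) t (stage (\<lambda>i. i \<in> A) t) e x m"
    unfolding e(1) by (rule clause_intros)
  then show ?case by (rule stage_ge)
next
  case (1 x)
  then have "e = 0" by (rule program_of_eqD)
  then have "clause (\<lambda>i. i \<in> A) 0 (stage (\<lambda>i. i \<in> A) 0) e x 0"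
    by (simp add: clause_def)
  then show ?case by (rule stage_ge)
next
  case (2 x)
  then have "e = 1" by (rule program_of_eqD)
  then have "clause (\<lambda>i. i \<in> A) 0 (stage (\<lambda>i. i \<in> A) 0) e x (Suc x)"
    by (simp add: clause_def)
  then show ?case by (rule stage_ge)
next
  case (3 x)
  then have "e = 2" by (rule program_of_eqD)
  then have "clause (\<lambda>i. i \<in> A) 0 (stage (\<lambda>i. i \<in> A) 0) e x (pfst x)"
    by (simp add: clause_def)
  then show ?case by (rule stage_ge)
next
  case (4 x)
  then have "e = 3" by (rule program_of_eqD)
  then have "clause (\<lambda>i. i \<in> A) 0 (stage (\<lambda>i. i \<in> A) 0) e x (psnd x)"
    by (simp add: clause_def)
  then show ?case by (rule stage_ge)
next
  case (5 x)
  then have "e = 4" by (rule program_of_eqD)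
  then have "clause (\<lambda>i. i \<in> A) 0 (stage (\<lambda>i. i \<in> A) 0) e x (if x \<in> A then 1 else 0)"
    by (simp add: clause_def)
  then show ?case by (rule stage_ge)
qed

lemma computes_iff_stage:
  "computes A (program_of e) x y \<longleftrightarrow> (\<exists>t. triple e x y \<in> set_decode (stage (\<lambda>i. i \<in> A) t))"
  using stage_sound stage_complete by blast


text \<open>The oracle may vary with a parameter \<open>p x\<close>. This allows running a
  computation relative to a decidable approximation of the jump.\<close>

lemma rec_in_stage:
  assumes "dec_in A (\<lambda>z. Or (pfst z) (psnd z))" "rec_in A p" "rec_in A t"
  shows "rec_in A (\<lambda>x. stage (Or (p x)) (t x))"
proof -
  \<comment> \<open>The code of a bounded decidable set is a finite sum of powers of 2, so the step
    from one stage to the next is arithmetic with bounded quantifiers.\<close>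
  have enc: "set_encode {z. z < t \<and> Q z} = (\<Sum>z<t. of_bool (Q z) * 2 ^ z)" for t Q
    unfolding set_encode_def
    by (simp add: sum.inter_filter[symmetric] of_bool_def if_distrib[where f = "\<lambda>x. x * _"] cong: if_cong)
  have st: "stage Or t = rec_nat 0 (\<lambda>t d. \<Sum>z<t. of_bool (clause Or t d (pfst z) (pfst (psnd z)) (psnd (psnd z))) * 2 ^ z) t"
    for Or t by (induction t) (simp_all add: enc)
  show ?thesis
    unfolding st clause_def triple_def
    by (intro rec_in_rec rec_in_intros dec_in_intros dec_in_apply2[OF assms(1)] assms
        rec_in_compose[OF assms(2)])
qed

section \<open>Computably enumerable predicates and their closure properties\<close>

lemma ce_in_ex_dec:
  assumes "dec_in A (\<lambda>z. R (pfst z) (psnd z))"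
  shows "ce_in A (\<lambda>x. \<exists>t. R x t)"
proof -
  obtain p where p: "\<And>z. computes A p z (of_bool (\<not> R (pfst z) (psnd z)))"
    using dec_in_not[OF assms] unfolding dec_in_def rec_in_def by blast
  have "computes A (Mu p) x (LEAST t. R x t)" if "\<exists>t. R x t" for x
  proof (rule computes.intros(10))
    show "computes A p (prod_encode (x, LEAST t. R x t)) 0"
      using p[of "prod_encode (x, LEAST t. R x t)"] LeastI_ex[OF that] by simp
    have "computes A p (prod_encode (x, l)) 1" if "l < (LEAST t. R x t)" for l
      using p[of "prod_encode (x, l)"] not_less_Least[OF that] by simp
    then show "\<forall>l<(LEAST t. R x t). \<exists>y>0. computes A p (prod_encode (x, l)) y"
      by (metis zero_less_one)
  qed
  moreover have "R x t" if "computes A (Mu p) x t" for x t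
    using that
  proof (cases rule: computes.cases)
    case 10
    then show ?thesis
      using computes_deterministic[OF p[of "prod_encode (x, t)"]] by fastforce
  qed
  ultimately show ?thesis unfolding ce_in_def by blast
qed

text \<open>Kleene normal form: the witness codes an output together with a stage at which that
  output has appeared.\<close>

lemma ce_in_normal_form:
  assumes "ce_in A P"
  shows "\<exists>R. dec_in A (\<lambda>z. R (pfst z) (psnd z)) \<and> (\<forall>x. P x \<longleftrightarrow> (\<exists>t. R x t))"
proof -
  obtain e where e: "\<And>x. P x \<longleftrightarrow> (\<exists>y. computes A (program_of e) x y)"
    using assms program_of_surj unfolding ce_in_def by metis
  define R where "R x w \<longleftrightarrow> triple e x (pfst w) \<in> set_decode (stage (\<lambda>i. i \<in> A) (psnd w))" for x w
  have "dec_in A (\<lambda>z. R (pfst z) (psnd z))"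
    unfolding R_def triple_def
    by (intro dec_in_intros rec_in_intros rec_in_stage[where p = "\<lambda>x. x"] dec_in_compose[OF dec_in_oracle])
  moreover have "P x \<longleftrightarrow> (\<exists>w. R x w)" for x
    unfolding e computes_iff_stage R_def by (metis fst_conv snd_conv prod_encode_inverse)
  ultimately show ?thesis by blast
qed

lemma ce_in_dec: "dec_in A P \<Longrightarrow> ce_in A P"
  using ce_in_ex_dec[of A "\<lambda>x t. P x"] dec_in_compose[OF _ rec_in_fst[OF rec_in_id]] by simp

lemma ce_in_compose: "ce_in A P \<Longrightarrow> rec_in A f \<Longrightarrow> ce_in A (\<lambda>x. P (f x))"
proof -
  assume "ce_in A P" "rec_in A f"
  then obtain p q where "\<And>x. P x \<longleftrightarrow> (\<exists>y. computes A p x y)" "\<And>x. computes A q x (f x)"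
    unfolding ce_in_def rec_in_def by blast
  moreover have "(\<exists>z. computes A (Comp p q) x z) \<longleftrightarrow> (\<exists>z. computes A p (f x) z)"
    if q: "\<And>x. computes A q x (f x)" for x q
  proof
    assume "\<exists>z. computes A (Comp p q) x z"
    then obtain y z where "computes A q x y" "computes A p y z"
      by (auto elim: computes.cases)
    then show "\<exists>z. computes A p (f x) z"
      using computes_deterministic[OF q] by blast
  qed (use q computes.intros(7) in blast)
  ultimately show ?thesis unfolding ce_in_def by metis
qed

lemma ce_in_ex:
  assumes "ce_in A (\<lambda>z. P (pfst z) (psnd z))" shows "ce_in A (\<lambda>x. \<exists>i. P x i)"
proof -
  obtain R where R: "dec_in A (\<lambda>z. R (pfst z) (psnd z))" "\<And>z. P (pfst z) (psnd z) \<longleftrightarrow> (\<exists>t. R z t)"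
    using ce_in_normal_form[OF assms] by blast
  have "P x i \<longleftrightarrow> (\<exists>t. R (prod_encode (x, i)) t)" for x i
    using R(2)[of "prod_encode (x, i)"] by simp
  then have "(\<exists>i. P x i) \<longleftrightarrow> (\<exists>w. R (prod_encode (x, pfst w)) (psnd w))" for x
    by (metis fst_conv snd_conv prod_encode_inverse)
  then show ?thesis
    by simp (intro ce_in_ex_dec dec_in_apply2[OF R(1)] rec_in_intros)
qed

text \<open>Finitely many witnesses have a common bound, here the successor of their sum, so the
  bounded quantifier moves inside one existential quantifier over that bound.\<close>

lemma ce_in_all_less:
  assumes "rec_in A b" "ce_in A (\<lambda>z. P (pfst z) (psnd z))" shows "ce_in A (\<lambda>x. \<forall>i<b x. P x i)"
proof -
  obtain R where R: "dec_in A (\<lambda>z. R (pfst z) (psnd z))" "\<And>z. P (pfst z) (psnd z) \<longleftrightarrow> (\<exists>t. R z t)"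
    using ce_in_normal_form[OF assms(2)] by blast
  have P: "P x i \<longleftrightarrow> (\<exists>t. R (prod_encode (x, i)) t)" for x i
    using R(2)[of "prod_encode (x, i)"] by simp
  have "(\<forall>i<b x. P x i) \<longleftrightarrow> (\<exists>w. \<forall>i<b x. \<exists>t<w. R (prod_encode (x, i)) t)" for x
  proof
    assume "\<forall>i<b x. P x i"
    then obtain t where t: "\<And>i. i < b x \<Longrightarrow> R (prod_encode (x, i)) (t i)"
      unfolding P by metis
    have "t i < Suc (\<Sum>i<b x. t i)" if "i < b x" for i
      using that by (intro le_imp_less_Suc member_le_sum) auto
    with t show "\<exists>w. \<forall>i<b x. \<exists>t<w. R (prod_encode (x, i)) t" by blast
  qed (auto simp: P)
  then show ?thesis
    by simp (intro ce_in_ex_dec dec_in_intros dec_in_apply2[OF R(1)] rec_in_intros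
        rec_in_compose[OF assms(1)])
qed

lemma ce_in_conj:
  assumes "ce_in A P" "ce_in A Q" shows "ce_in A (\<lambda>x. P x \<and> Q x)"
proof -
  obtain R S where R: "dec_in A (\<lambda>z. R (pfst z) (psnd z))" "\<And>x. P x \<longleftrightarrow> (\<exists>t. R x t)"
    and S: "dec_in A (\<lambda>z. S (pfst z) (psnd z))" "\<And>x. Q x \<longleftrightarrow> (\<exists>t. S x t)"
    using ce_in_normal_form[OF assms(1)] ce_in_normal_form[OF assms(2)] by blast
  have "P x \<and> Q x \<longleftrightarrow> (\<exists>w. R x (pfst w) \<and> S x (psnd w))" for x
    unfolding R S by (metis fst_conv snd_conv prod_encode_inverse)
  then show ?thesis
    by simp (intro ce_in_ex_dec dec_in_intros dec_in_apply2[OF R(1)] dec_in_apply2[OF S(1)]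
        rec_in_intros)
qed

lemma ce_in_disj:
  assumes "ce_in A P" "ce_in A Q" shows "ce_in A (\<lambda>x. P x \<or> Q x)"
proof -
  obtain R S where R: "dec_in A (\<lambda>z. R (pfst z) (psnd z))" "\<And>x. P x \<longleftrightarrow> (\<exists>t. R x t)"
    and S: "dec_in A (\<lambda>z. S (pfst z) (psnd z))" "\<And>x. Q x \<longleftrightarrow> (\<exists>t. S x t)"
    using ce_in_normal_form[OF assms(1)] ce_in_normal_form[OF assms(2)] by blast
  have "P x \<or> Q x \<longleftrightarrow> (\<exists>w. R x w \<or> S x w)" for x
    unfolding R S by blast
  then show ?thesis
    by simp (intro ce_in_ex_dec dec_in_intros dec_in_apply2[OF R(1)] dec_in_apply2[OF S(1)]
        rec_in_intros)
qed

lemmas ce_in_intros = ce_in_conj ce_in_disj ce_in_ex ce_in_all_less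

lemma ce_in_computes:
  assumes "rec_in A e" "rec_in A f" "rec_in A g"
  shows "ce_in A (\<lambda>x. computes A (program_of (e x)) (f x) (g x))"
  unfolding computes_iff_stage triple_def
  by (intro ce_in_ex_dec dec_in_intros rec_in_intros rec_in_stage[where p = "\<lambda>x. x"]
      dec_in_compose[OF dec_in_oracle] rec_in_compose[OF assms(1)] rec_in_compose[OF assms(2)]
      rec_in_compose[OF assms(3)])

lemma ce_in_ce_set:
  assumes "rec_in A e" "rec_in A f"
  shows "ce_in A (\<lambda>x. f x \<in> ce_set A (e x))"
  unfolding ce_set_def mem_Collect_eq
  by (intro ce_in_intros ce_in_computes rec_in_compose[OF assms(1)] rec_in_compose[OF assms(2)] rec_in_intros)

text \<open>The search runs over pairs of a candidate and a certificate for it, a decidable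
  condition; only the candidate is kept.\<close>

lemma rec_in_choice:
  assumes "ce_in A (\<lambda>z. P (pfst z) (psnd z))" "\<And>x. \<exists>i. P x i"
  shows "\<exists>g. rec_in A g \<and> (\<forall>x. P x (g x))"
proof -
  obtain R where R: "dec_in A (\<lambda>z. R (pfst z) (psnd z))" "\<And>z. P (pfst z) (psnd z) \<longleftrightarrow> (\<exists>t. R z t)"
    using ce_in_normal_form[OF assms(1)] by blast
  have P: "P x i \<longleftrightarrow> (\<exists>t. R (prod_encode (x, i)) t)" for x i
    using R(2)[of "prod_encode (x, i)"] by simp
  have "\<exists>w. R (prod_encode (x, pfst w)) (psnd w)" for x
    using assms(2)[of x] unfolding P by (metis fst_conv snd_conv prod_encode_inverse)
  then have "\<exists>g. rec_in A g \<and> (\<forall>x. R (prod_encode (x, pfst (g x))) (psnd (g x)))"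
    by (intro rec_in_search[where P = "\<lambda>x w. R (prod_encode (x, pfst w)) (psnd w)"]
        dec_in_apply2[OF R(1)] rec_in_intros)
  then obtain g where "rec_in A g" "\<And>x. R (prod_encode (x, pfst (g x))) (psnd (g x))"
    by blast
  then show ?thesis
    unfolding P by (intro exI[of _ "\<lambda>x. pfst (g x)"]) (auto intro: rec_in_fst)
qed

text \<open>Index of the program that applies \<open>Succ\<close> (index 1) \<open>k\<close> times
  to \<open>Zero\<close>; the form 6 + 4 * _ codes \<open>Comp\<close>.\<close>

primrec const_index :: "nat \<Rightarrow> nat" where
  "const_index 0 = 0"
| "const_index (Suc k) = 6 + 4 * prod_encode (1, const_index k)"

text \<open>The s-m-n function: program \<open>e\<close> is composed with the map from x to (k, x),
  where the inner \<open>Tuple Fst Snd\<close>, with indices 2 and 3, is the identity.\<close>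

definition smn :: "nat \<Rightarrow> nat \<Rightarrow> nat" where
  "smn e k = 6 + 4 * prod_encode (e, 5 + 4 * prod_encode (const_index k, 5 + 4 * prod_encode (2, 3)))"

lemma rec_in_smn: "rec_in A (smn e)"
proof -
  have "const_index k = rec_nat 0 (\<lambda>_ y. 6 + 4 * prod_encode (1, y)) k" for k
    by (induction k) auto
  then show ?thesis
    unfolding smn_def[abs_def] by simp (intro rec_in_rec rec_in_intros)
qed

lemma computes_const_index: "computes A (program_of (const_index k)) x k"
  by (induction k) (auto simp: program_of_simps intro: computes.intros)

lemma computes_smn_iff:
  "computes A (program_of (smn e k)) x y \<longleftrightarrow> computes A (program_of e) (prod_encode (k, x)) y"
proof -
  let ?q = "Tuple (program_of (const_index k)) (Tuple Fst Snd)"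
  have p: "program_of (smn e k) = Comp (program_of e) ?q"
    by (simp add: smn_def program_of_simps)
  have "computes A (Tuple Fst Snd) x x"
    using computes.intros(6)[OF computes.intros(3,4), of A x] by simp
  then have q: "computes A ?q x (prod_encode (k, x))"
    by (intro computes.intros(6) computes_const_index)
  show ?thesis
  proof
    assume "computes A (program_of (smn e k)) x y"
    then obtain z where "computes A ?q x z" "computes A (program_of e) z y"
      unfolding p by (auto elim: computes.cases)
    then show "computes A (program_of e) (prod_encode (k, x)) y"
      using computes_deterministic[OF q] by blast
  qed (use q computes.intros(7) p in metis)
qed

text \<open>The index function needs no oracle: \<open>A\<close> affects only the fixed index
  \<open>e\<close>, and \<open>smn\<close> merely manipulates program text. This matches
  \<open>uniformly\<close>, which asks for oracle-free index functions.\<close>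

lemma ce_in_uniform_index:
  assumes "ce_in A (\<lambda>z. P (pfst z) (psnd z))"
  shows "\<exists>f. rec_in {} f \<and> (\<forall>k. ce_set A (f k) = {x. P k x})"
proof -
  obtain e where e: "\<And>z. P (pfst z) (psnd z) \<longleftrightarrow> (\<exists>y. computes A (program_of e) z y)"
    using assms program_of_surj unfolding ce_in_def by metis
  have "ce_set A (smn e k) = {x. P k x}" for k
    using e[of "prod_encode (k, x)" for x] by (auto simp: ce_set_def computes_smn_iff)
  then show ?thesis using rec_in_smn by blast
qed

lemma rec_in_uniform_index:
  assumes "rec_in A (\<lambda>z. g (pfst z) (psnd z))"
  shows "\<exists>f. rec_in {} f \<and> (\<forall>k x. computes A (program_of (f k)) x (g k x))"
proof -
  obtain e where e: "\<And>z. computes A (program_of e) z (g (pfst z) (psnd z))"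
    using assms program_of_surj unfolding rec_in_def by metis
  have "computes A (program_of (smn e k)) x (g k x)" for k x
    using e[of "prod_encode (k, x)"] by (simp add: computes_smn_iff)
  then show ?thesis using rec_in_smn by blast
qed

text \<open>Without an oracle every query returns 0.\<close>

primrec drop_queries :: "program \<Rightarrow> program" where
  "drop_queries Zero = Zero"
| "drop_queries Succ = Succ"
| "drop_queries Fst = Fst"
| "drop_queries Snd = Snd"
| "drop_queries Query = Zero"
| "drop_queries (Tuple p q) = Tuple (drop_queries p) (drop_queries q)"
| "drop_queries (Comp p q) = Comp (drop_queries p) (drop_queries q)"
| "drop_queries (Prim p q) = Prim (drop_queries p) (drop_queries q)"
| "drop_queries (Mu p) = Mu (drop_queries p)"

lemma computes_drop_queries: "computes {} p x y \<Longrightarrow> computes A (drop_queries p) x y"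
proof (induction rule: computes.induct)
  case (10 p x m)
  then show ?case by simp (metis computes.intros(10))
qed (auto intro: computes.intros)

lemma rec_in_empty: "rec_in {} f \<Longrightarrow> rec_in A f"
  unfolding rec_in_def using computes_drop_queries by blast

lemma ce_in_empty: 
  assumes "ce_in {} P" shows "ce_in A P"
proof -
  obtain R where R: "dec_in {} (\<lambda>z. R (pfst z) (psnd z))" "\<And>x. P x \<longleftrightarrow> (\<exists>t. R x t)"
    using ce_in_normal_form[OF assms] by blast
  then have "ce_in A (\<lambda>x. \<exists>t. R x t)"
    using rec_in_empty unfolding dec_in_def by (intro ce_in_ex_dec) (simp add: dec_in_def)
  moreover have "P = (\<lambda>x. \<exists>t. R x t)" by (intro ext R(2))
  ultimately show ?thesis by simp
qed

lemma ce_in_ce_set_empty: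
  assumes "rec_in A e" "rec_in A f" shows "ce_in A (\<lambda>x. f x \<in> ce_set {} (e x))"
  using ce_in_compose[OF ce_in_empty[OF ce_in_ce_set[OF rec_in_fst rec_in_snd, OF rec_in_id rec_in_id]]
      rec_in_pair[OF assms]] by simp

section \<open>The Turing jump\<close>

lemma clause_cong_oracle:
  "(e = 4 \<Longrightarrow> Or x = Or' x) \<Longrightarrow> clause Or t d e x y = clause Or' t d e x y"
  unfolding clause_def by (cases "e = 4") simp_all

text \<open>The use principle. A query concerns the input component of an entry, and components of a
  pair are bounded by its code, so an entry below \<open>t\<close> queries the oracle below
  \<open>t\<close>.\<close>

lemma stage_cong_oracle: "(\<And>i. i < t \<Longrightarrow> Or i = Or' i) \<Longrightarrow> stage Or t = stage Or' t"
proof (induction t)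
  case (Suc t)
  have "clause Or t (stage Or t) (pfst z) (pfst (psnd z)) (psnd (psnd z)) =
      clause Or' t (stage Or' t) (pfst z) (pfst (psnd z)) (psnd (psnd z))" if "z < t" for z
  proof -
    have "pfst (psnd z) < Suc t"
      using that fst_prod_decode_le[of "psnd z"] snd_prod_decode_le[of z] by linarith
    then show ?thesis using Suc by (simp add: clause_cong_oracle[of _ Or _ Or'])
  qed
  then have "{z. z < t \<and> clause Or t (stage Or t) (pfst z) (pfst (psnd z)) (psnd (psnd z))} =
    {z. z < t \<and> clause Or' t (stage Or' t) (pfst z) (pfst (psnd z)) (psnd (psnd z))}"
    by blast
  then show ?case by simp
qed simp

text \<open>
  The limit lemma for c.e. sets: \<open>turing_jump A\<close> is approximated from below by
  \<open>A\<close>-decidable finite stages, and a halting computation only looks at finitely many oracle values.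
\<close>

lemma ce_in_turing_jump:
  assumes "ce_in (turing_jump A) P"
  obtains R where "dec_in A (\<lambda>z. R (pfst z) (pfst (psnd z)) (psnd (psnd z)))"
    "\<And>x. P x \<longleftrightarrow> (\<exists>y. \<forall>t. R x y t)"
proof -
  obtain e where e: "\<And>x. P x \<longleftrightarrow> (\<exists>y. computes (turing_jump A) (program_of e) x y)"
    using assms program_of_surj unfolding ce_in_def by metis
  obtain J where J: "dec_in A (\<lambda>z. J (pfst z) (psnd z))"
    "\<And>z. pfst z \<in> ce_set A (psnd z) \<longleftrightarrow> (\<exists>t. J z t)"
    using ce_in_normal_form[OF ce_in_ce_set[OF rec_in_snd rec_in_fst, OF rec_in_id rec_in_id]]
    by blast
  \<comment> \<open>Approximation to the jump with witnesses below \<open>t\<close>. It only grows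
    with \<open>t\<close>, so on a bounded set of arguments it is eventually correct.\<close>
  define Or where "Or t i \<longleftrightarrow> (\<exists>u<t. J (prod_encode (i, i)) u)" for t i
  have jump: "i \<in> turing_jump A \<longleftrightarrow> (\<exists>t. J (prod_encode (i, i)) t)" for i
    using J(2)[of "prod_encode (i, i)"] by (simp add: turing_jump_def)
  have "\<exists>t0. \<forall>t\<ge>t0. stage (Or t) T = stage (\<lambda>i. i \<in> turing_jump A) T" for T
  proof -
    have "\<exists>t0. \<forall>t\<ge>t0. Or t i \<longleftrightarrow> i \<in> turing_jump A" for i
    proof (cases "i \<in> turing_jump A")
      case True
      then obtain u where "J (prod_encode (i, i)) u" using jump by blast
      then show ?thesis using True unfolding Or_def by (intro exI[of _ "Suc u"]) (auto intro!: exI[of _ u])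
    qed (auto simp: Or_def jump)
    then obtain t0 where t0: "\<And>i t. t0 i \<le> t \<Longrightarrow> Or t i \<longleftrightarrow> i \<in> turing_jump A" by metis
    have "t0 i \<le> (\<Sum>i<T. t0 i)" if "i < T" for i
      using that by (intro member_le_sum) auto
    then show ?thesis
      by (intro exI[of _ "\<Sum>i<T. t0 i"] allI impI stage_cong_oracle t0) (meson le_trans)
  qed
  then obtain t0 where t0: "\<And>T t. t0 T \<le> t \<Longrightarrow> stage (Or t) T = stage (\<lambda>i. i \<in> turing_jump A) T"
    by metis
  \<comment> \<open>Here \<open>w\<close> codes a threshold, an output and a stage. The condition is
    vacuous before the threshold. A true computation is witnessed by a threshold after which the
    approximation is correct; conversely, a \<open>t\<close> beyond both the threshold and the
    settling time \<open>t0\<close> reveals a true computation.\<close>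
  define R where "R x w t \<longleftrightarrow> pfst w \<le> t \<longrightarrow>
    triple e x (pfst (psnd w)) \<in> set_decode (stage (Or t) (psnd (psnd w)))" for x w t
  have "P x \<longleftrightarrow> (\<exists>w. \<forall>t. R x w t)" for x
  proof
    assume "P x"
    then obtain y T where *: "triple e x y \<in> set_decode (stage (\<lambda>i. i \<in> turing_jump A) T)"
      unfolding e computes_iff_stage by blast
    then have "R x (prod_encode (t0 T, prod_encode (y, T))) t" for t
      by (simp add: R_def t0)
    then show "\<exists>w. \<forall>t. R x w t" by blast
  next
    assume "\<exists>w. \<forall>t. R x w t"
    then obtain w where "\<And>t. R x w t" by blast
    from this[of "max (pfst w) (t0 (psnd (psnd w)))"] show "P x"
      unfolding e computes_iff_stage by (auto simp: R_def t0)
  qed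
  moreover have "dec_in A (\<lambda>z. R (pfst z) (pfst (psnd z)) (psnd (psnd z)))"
    unfolding R_def triple_def
    by (intro dec_in_intros rec_in_intros rec_in_stage[where Or = Or])
      (unfold Or_def, intro dec_in_intros rec_in_intros dec_in_apply2[OF J(1)])+
  ultimately show ?thesis using that by blast
qed

section \<open>Computable sequences of real numbers\<close>

text \<open>Only nonnegative rationals are represented, as fractions of natural numbers. Signs never
  arise, because the inequalities to be decided are arranged with sums on both sides.\<close>

definition rat_in :: "nat set \<Rightarrow> (nat \<Rightarrow> real) \<Rightarrow> bool" where
  "rat_in A r \<longleftrightarrow> (\<exists>a b. rec_in A a \<and> rec_in A b \<and> (\<forall>x. b x > 0 \<and> r x = real (a x) / real (b x)))"

lemma rat_inI:
  assumes "rec_in A a" "rec_in A b" "\<And>x. b x > 0" "\<And>x. r x = real (a x) / real (b x)"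
  shows "rat_in A r"
  using assms unfolding rat_in_def by blast

lemma rat_in_of_nat: "rec_in A f \<Longrightarrow> rat_in A (\<lambda>x. real (f x))"
  by (rule rat_inI[where a = f and b = "\<lambda>x. 1"]) (auto intro: rec_in_const)

lemma rat_in_compose:
  assumes "rat_in A r" "rec_in A f" shows "rat_in A (\<lambda>x. r (f x))"
proof -
  obtain a b where "rec_in A a" "rec_in A b" "\<And>x. b x > 0 \<and> r x = real (a x) / real (b x)"
    using assms(1) unfolding rat_in_def by blast
  then show ?thesis
    by (intro rat_inI[where a = "\<lambda>x. a (f x)" and b = "\<lambda>x. b (f x)"])
      (auto intro: rec_in_compose assms)
qed

lemma rat_in_add:
  assumes "rat_in A r" "rat_in A r'" shows "rat_in A (\<lambda>x. r x + r' x)"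
proof -
  obtain a b a' b' where *: "rec_in A a" "rec_in A b" "\<And>x. b x > 0 \<and> r x = real (a x) / real (b x)"
    "rec_in A a'" "rec_in A b'" "\<And>x. b' x > 0 \<and> r' x = real (a' x) / real (b' x)"
    using assms unfolding rat_in_def by metis
  show ?thesis
    by (rule rat_inI[where a = "\<lambda>x. a x * b' x + a' x * b x" and b = "\<lambda>x. b x * b' x"])
      (use *(3,6) in \<open>auto intro!: rec_in_intros * simp: add_frac_eq\<close>)
qed

lemma rat_in_mult:
  assumes "rat_in A r" "rat_in A r'" shows "rat_in A (\<lambda>x. r x * r' x)"
proof -
  obtain a b a' b' where *: "rec_in A a" "rec_in A b" "\<And>x. b x > 0 \<and> r x = real (a x) / real (b x)"
    "rec_in A a'" "rec_in A b'" "\<And>x. b' x > 0 \<and> r' x = real (a' x) / real (b' x)"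
    using assms unfolding rat_in_def by metis
  show ?thesis
    by (rule rat_inI[where a = "\<lambda>x. a x * a' x" and b = "\<lambda>x. b x * b' x"])
      (use *(3,6) in \<open>auto intro!: rec_in_intros *\<close>)
qed

lemma rat_in_divide:
  assumes "rat_in A r" "rat_in A r'" shows "rat_in A (\<lambda>x. r x / r' x)"
proof -
  obtain a b a' b' where *: "rec_in A a" "rec_in A b" "\<And>x. b x > 0 \<and> r x = real (a x) / real (b x)"
    "rec_in A a'" "rec_in A b'" "\<And>x. b' x > 0 \<and> r' x = real (a' x) / real (b' x)"
    using assms unfolding rat_in_def by metis
  show ?thesis
    \<comment> \<open>Division by zero yields 0, represented as 0/1 so that the denominator stays
      positive.\<close>
    by (rule rat_inI[where a = "\<lambda>x. if a' x = 0 then 0 else a x * b' x"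
          and b = "\<lambda>x. if a' x = 0 then 1 else b x * a' x"])
      (use *(3,6) in \<open>auto intro!: rec_in_intros dec_in_intros *\<close>)
qed

lemma rat_in_two_power: "rec_in A f \<Longrightarrow> rat_in A (\<lambda>x. 2 ^ f x)"
  using rat_in_of_nat[OF rec_in_power[OF rec_in_const[of _ 2]]] by simp

lemma rat_in_1: "rat_in A (\<lambda>x. 1)"
  using rat_in_of_nat[OF rec_in_const[of _ 1]] by simp

lemma dec_in_rat_le:
  assumes "rat_in A r" "rat_in A r'" shows "dec_in A (\<lambda>x. r x \<le> r' x)"
proof -
  obtain a b a' b' where *: "rec_in A a" "rec_in A b" "\<And>x. b x > 0 \<and> r x = real (a x) / real (b x)"
    "rec_in A a'" "rec_in A b'" "\<And>x. b' x > 0 \<and> r' x = real (a' x) / real (b' x)"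
    using assms unfolding rat_in_def by metis
  have "r x \<le> r' x \<longleftrightarrow> a x * b' x \<le> a' x * b x" for x
    using *(3,6)[of x] by (simp add: divide_le_eq pos_le_divide_eq flip: of_nat_mult)
  then show ?thesis by simp (intro dec_in_intros rec_in_intros *)
qed

lemma dec_in_rat_less:
  assumes "rat_in A r" "rat_in A r'" shows "dec_in A (\<lambda>x. r x < r' x)"
  using dec_in_not[OF dec_in_rat_le[OF assms(2,1)]] by (simp add: not_le)

lemmas rat_in_intros = rat_in_1 rat_in_of_nat rat_in_add rat_in_mult rat_in_divide rat_in_two_power

lemma rat_in_pos_rat: "rec_in A f \<Longrightarrow> rat_in A (\<lambda>x. pos_rat (f x))"
  unfolding pos_rat_def by (intro rat_in_intros rec_in_intros)

lemma rat_in_nat_to_rat_surj: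
  assumes "rec_in A f"
  shows "rat_in A (\<lambda>x. max 0 (of_rat (nat_to_rat_surj (f x))))"
proof -
  \<comment> \<open>The absolute value of \<open>int_decode n\<close>: even codes are the
    nonnegative integers, odd codes the negative ones.\<close>
  define mag where "mag n = Suc n div 2" for n :: nat
  \<comment> \<open>Equal parities mean that numerator and denominator have no opposite signs.
    Negative quotients and zero denominators are sent to 0, in accordance with
    \<open>max 0\<close>.\<close>
  define num where "num j = (if psnd j \<noteq> 0 \<and> even (pfst j + psnd j) then mag (pfst j) else 0)" for j
  define den where "den j = (if psnd j = 0 then 1 else mag (psnd j))" for j
  have dec: "int_decode n = (if even n then int (mag n) else - int (mag n))" for n
    by (auto simp: int_decode_def sum_decode_def mag_def elim!: evenE oddE)
  have [simp]: "mag 0 = 0" by (simp add: mag_def)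
  have den: "den j > 0" for j
    unfolding den_def mag_def by auto
  have "max 0 (of_rat (nat_to_rat_surj j) :: real) = real (num j) / real (den j)" for j
  proof -
    have "(of_rat (nat_to_rat_surj j) :: real) = of_int (int_decode (pfst j)) / of_int (int_decode (psnd j))"
      by (simp add: nat_to_rat_surj_def Let_def split_beta of_rat_divide Fract_of_int_quotient)
    then show ?thesis
      by (auto simp: dec num_def den_def max_def divide_le_0_iff zero_le_divide_iff)
  qed
  moreover have "rec_in A num" "rec_in A den"
    unfolding num_def[abs_def] den_def[abs_def] mag_def by (intro rec_in_intros dec_in_intros)+
  ultimately have "rat_in A (\<lambda>x. max 0 (of_rat (nat_to_rat_surj x)))"
    using den by (intro rat_inI[where a = num and b = den])
  from rat_in_compose[OF this assms] show ?thesis .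
qed

lemma rat_in_nat_to_rat_surjE:
  assumes "rat_in A r"
  obtains f where "rec_in A f" "\<And>x. of_rat (nat_to_rat_surj (f x)) = r x"
proof -
  obtain a b where *: "rec_in A a" "rec_in A b" "\<And>x. b x > 0 \<and> r x = real (a x) / real (b x)"
    using assms unfolding rat_in_def by blast
  have "int_decode (2 * n) = int n" for n
    by (simp add: int_decode_def sum_decode_def)
  then have "of_rat (nat_to_rat_surj (prod_encode (2 * a x, 2 * b x))) = r x" for x
    using *(3)[of x] by (simp add: nat_to_rat_surj_def Fract_of_int_quotient of_rat_divide)
  moreover have "rec_in A (\<lambda>x. prod_encode (2 * a x, 2 * b x))"
    by (intro rec_in_intros *)
  ultimately show ?thesis using that by blast
qed

text \<open>An index-free form of \<open>uniformly (computable_real_index A)\<close>; for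
  nonnegative sequences the next lemmas give both directions.\<close>

definition computable_seq :: "nat set \<Rightarrow> (nat \<Rightarrow> real) \<Rightarrow> bool" where
  "computable_seq A v \<longleftrightarrow>
    (\<exists>q. rat_in A q \<and> (\<forall>k m. \<bar>v k - q (prod_encode (k, m))\<bar> \<le> 1 / 2 ^ m))"

lemma computable_seqD:
  assumes "uniformly (computable_real_index A) v" "\<And>k. v k \<ge> 0"
  shows "computable_seq A v"
proof -
  obtain f where f: "rec_in {} f" "\<And>k. computable_real_index A (f k) (v k)"
    using assms(1) unfolding uniformly_def computable_fun_iff_rec_in by blast
  \<comment> \<open>The index function supplies programs; the universal program turns running them
    into one function computable in \<open>A\<close>.\<close>
  have "\<exists>g. rec_in A g \<and> (\<forall>z. computes A (program_of (f (pfst z))) (psnd z) (g z))"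
  proof (rule rec_in_choice)
    show "ce_in A (\<lambda>z. computes A (program_of (f (pfst (pfst z)))) (psnd (pfst z)) (psnd z))"
      by (intro ce_in_computes rec_in_compose[OF rec_in_empty[OF f(1)]] rec_in_intros)
    show "\<exists>j. computes A (program_of (f (pfst z))) (psnd z) j" for z
      using f(2)[of "pfst z"] unfolding computable_real_index_def by blast
  qed
  then obtain g where g: "rec_in A g" "\<And>z. computes A (program_of (f (pfst z))) (psnd z) (g z)"
    by blast
  have "\<bar>v k - max 0 (of_rat (nat_to_rat_surj (g (prod_encode (k, m)))))\<bar> \<le> 1 / 2 ^ m" for k m
  proof -
    obtain j where j: "computes A (program_of (f k)) m j" "\<bar>v k - of_rat (nat_to_rat_surj j)\<bar> \<le> 1 / 2 ^ m"
      using f(2)[of k] unfolding computable_real_index_def by blast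
    have "g (prod_encode (k, m)) = j"
      using computes_deterministic[OF j(1)] g(2)[of "prod_encode (k, m)"] by simp
    \<comment> \<open>Clipping an approximation of a nonnegative number at 0 does not increase its
      error.\<close>
    moreover have "\<bar>v k - max 0 w\<bar> \<le> e" if "\<bar>v k - w\<bar> \<le> e" for w e
      using that assms(2)[of k] by auto
    ultimately show ?thesis using j(2) by simp
  qed
  then show ?thesis
    unfolding computable_seq_def using rat_in_nat_to_rat_surj[OF g(1)] by blast
qed

lemma computable_real_imp_computable_seq:
  assumes "computable_real A r" "r \<ge> 0" shows "computable_seq A (\<lambda>_. r)"
proof (rule computable_seqD)
  obtain e where "computable_real_index A e r"
    using assms(1) unfolding computable_real_def by blast
  then show "uniformly (computable_real_index A) (\<lambda>_. r)"
    unfolding uniformly_def computable_fun_iff_rec_in using rec_in_const by blast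
qed (use assms in simp)

lemma computable_seq_imp_uniformly:
  assumes "computable_seq A v" shows "uniformly (computable_real_index A) v"
proof -
  obtain q where q: "rat_in A q" "\<And>k m. \<bar>v k - q (prod_encode (k, m))\<bar> \<le> 1 / 2 ^ m"
    using assms unfolding computable_seq_def by blast
  obtain g where g: "rec_in A g" "\<And>x. of_rat (nat_to_rat_surj (g x)) = q x"
    using rat_in_nat_to_rat_surjE[OF q(1)] by metis
  have "rec_in A (\<lambda>z. g (prod_encode (pfst z, psnd z)))" using g(1) by simp
  from rec_in_uniform_index[OF this] obtain f where
    f: "rec_in {} f" "\<And>k m. computes A (program_of (f k)) m (g (prod_encode (k, m)))"
    by blast
  have "computable_real_index A (f k) (v k)" for k
    unfolding computable_real_index_def using f(2) q(2) g(2) by metis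
  then show ?thesis
    unfolding uniformly_def computable_fun_iff_rec_in using f(1) by blast
qed

lemma computable_seq_empty: "computable_seq {} v \<Longrightarrow> computable_seq A v"
  unfolding computable_seq_def rat_in_def using rec_in_empty by metis

lemma ex_inverse_two_power_less:
  fixes \<epsilon> :: real assumes "\<epsilon> > 0" shows "\<exists>m. 1 / 2 ^ m < \<epsilon>"
  using real_arch_pow_inv[OF assms, of "1/2"] by (auto simp: power_one_over)

text \<open>A strict inequality leaves a gap, and an approximation whose error is below half the gap
  certifies it by a decidable comparison of rationals.\<close>

lemma ce_in_computable_seq_less:
  assumes "computable_seq A v" "rec_in A k" "rat_in A r" "rat_in A r'"
  shows "ce_in A (\<lambda>x. v (k x) + r x < r' x)"
proof -
  obtain q where q: "rat_in A q" "\<And>k m. \<bar>v k - q (prod_encode (k, m))\<bar> \<le> 1 / 2 ^ m"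
    using assms(1) unfolding computable_seq_def by blast
  have "v (k x) + r x < r' x \<longleftrightarrow> (\<exists>m. q (prod_encode (k x, m)) + 1 / 2 ^ m + r x < r' x)" for x
  proof
    assume "v (k x) + r x < r' x"
    then obtain m where "1 / 2 ^ m < (r' x - (v (k x) + r x)) / 2"
      using ex_inverse_two_power_less[of "(r' x - (v (k x) + r x)) / 2"] by auto
    then show "\<exists>m. q (prod_encode (k x, m)) + 1 / 2 ^ m + r x < r' x"
      using q(2)[of "k x" m] by (intro exI[of _ m]) (simp only: abs_le_iff less_divide_eq_numeral1; argo)
  next
    assume "\<exists>m. q (prod_encode (k x, m)) + 1 / 2 ^ m + r x < r' x"
    then obtain m where "q (prod_encode (k x, m)) + 1 / 2 ^ m + r x < r' x" ..
    then show "v (k x) + r x < r' x" using q(2)[of "k x" m] by linarith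
  qed
  then show ?thesis
    by simp (intro ce_in_ex_dec dec_in_rat_less rat_in_intros rec_in_intros rat_in_compose[OF q(1)]
        rat_in_compose[OF assms(3)] rat_in_compose[OF assms(4)] rec_in_compose[OF assms(2)])
qed

lemma ce_in_less_computable_seq:
  assumes "computable_seq A v" "rec_in A k" "rat_in A r"
  shows "ce_in A (\<lambda>x. r x < v (k x))"
proof -
  obtain q where q: "rat_in A q" "\<And>k m. \<bar>v k - q (prod_encode (k, m))\<bar> \<le> 1 / 2 ^ m"
    using assms(1) unfolding computable_seq_def by blast
  have "r x < v (k x) \<longleftrightarrow> (\<exists>m. r x + 1 / 2 ^ m < q (prod_encode (k x, m)))" for x
  proof
    assume "r x < v (k x)"
    then obtain m where "1 / 2 ^ m < (v (k x) - r x) / 2"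
      using ex_inverse_two_power_less[of "(v (k x) - r x) / 2"] by auto
    then show "\<exists>m. r x + 1 / 2 ^ m < q (prod_encode (k x, m))"
      using q(2)[of "k x" m] by (intro exI[of _ m]) (simp only: abs_le_iff less_divide_eq_numeral1; argo)
  next
    assume "\<exists>m. r x + 1 / 2 ^ m < q (prod_encode (k x, m))"
    then obtain m where "r x + 1 / 2 ^ m < q (prod_encode (k x, m))" ..
    then show "r x < v (k x)" using q(2)[of "k x" m] by linarith
  qed
  then show ?thesis
    by simp (intro ce_in_ex_dec dec_in_rat_less rat_in_intros rec_in_intros rat_in_compose[OF q(1)]
        rat_in_compose[OF assms(3)] rec_in_compose[OF assms(2)])
qed

text \<open>Convergent lower bounds, not necessarily monotone in \<open>t\<close>. The common
  denominator 2^t lets sums of bounds at the same stage be formed with natural numbers.\<close>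

definition lower_seq :: "nat set \<Rightarrow> (nat \<Rightarrow> real) \<Rightarrow> bool" where
  "lower_seq A v \<longleftrightarrow> (\<exists>g. rec_in A g \<and> (\<forall>k. (\<forall>t. real (g (prod_encode (k, t))) / 2 ^ t \<le> v k) \<and>
     (\<lambda>t. real (g (prod_encode (k, t))) / 2 ^ t) \<longlonglongrightarrow> v k))"

lemma lower_seq_compose:
  assumes "lower_seq A v" "rec_in A f" shows "lower_seq A (\<lambda>k. v (f k))"
proof -
  obtain g where g: "rec_in A g" "\<And>k t. real (g (prod_encode (k, t))) / 2 ^ t \<le> v k"
     "\<And>k. (\<lambda>t. real (g (prod_encode (k, t))) / 2 ^ t) \<longlonglongrightarrow> v k"
    using assms(1) unfolding lower_seq_def by blast
  have "rec_in A (\<lambda>z. g (prod_encode (f (pfst z), psnd z)))"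
    by (intro rec_in_compose[OF g(1)] rec_in_compose[OF assms(2)] rec_in_intros)
  then show ?thesis
    unfolding lower_seq_def using g(2,3)
    by (intro exI[of _ "\<lambda>z. g (prod_encode (f (pfst z), psnd z))"]) auto
qed

lemma lower_seqI:
  assumes ce: "ce_in A (\<lambda>z. of_rat (nat_to_rat_surj (psnd z)) < v (pfst z))"
    and v: "\<And>k. 0 \<le> v k" "\<And>k. v k \<le> 1"
  shows "lower_seq A v"
proof -
  define q :: "nat \<Rightarrow> real" where "q j = max 0 (of_rat (nat_to_rat_surj j))" for j
  have q: "rat_in A q" unfolding q_def[abs_def] by (intro rat_in_nat_to_rat_surj rec_in_id)
  obtain R where R: "dec_in A (\<lambda>z. R (pfst z) (psnd z))"
    "\<And>z. of_rat (nat_to_rat_surj (psnd z)) < v (pfst z) \<longleftrightarrow> (\<exists>u. R z u)"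
    using ce_in_normal_form[OF ce] by blast
  \<comment> \<open>An initial segment of the naturals; its size divided by 2^t is the best lower
    bound confirmed within \<open>t\<close> steps, rounded down to a multiple of 1/2^t. Counting
    replaces taking a maximum, and the cutoff at 2^t loses nothing because \<open>v k\<close> is at
    most 1.\<close>
  define S where "S k t = {a. a < 2 ^ t \<and> (\<exists>j<t. \<exists>u<t. R (prod_encode (k, j)) u \<and> real (Suc a) \<le> 2 ^ t * q j)}" for k t
  define g where "g z = (\<Sum>a<2 ^ psnd z. of_bool (a \<in> S (pfst z) (psnd z)) :: nat)" for z
  have fin: "finite (S k t)" for k t by (simp add: S_def)
  have g: "g (prod_encode (k, t)) = card (S k t)" for k t
  proof -
    have "{..<2 ^ t} \<inter> {a. a \<in> S k t} = S k t" by (auto simp: S_def)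
    then show ?thesis by (simp add: g_def)
  qed
  have R': "q j \<le> v k" if "R (prod_encode (k, j)) u" for j k u
    using that R(2)[of "prod_encode (k, j)"] v(1)[of k] by (auto simp: q_def)
  have upper: "real (g (prod_encode (k, t))) / 2 ^ t \<le> v k" for k t
  proof -
    have "S k t \<subseteq> {..<nat \<lfloor>2 ^ t * v k\<rfloor>}"
    proof
      fix a assume "a \<in> S k t"
      then obtain j u where "R (prod_encode (k, j)) u" "real (Suc a) \<le> 2 ^ t * q j"
        by (auto simp: S_def)
      then have "real (Suc a) \<le> 2 ^ t * v k"
        using R'[of k j u] mult_left_mono[of "q j" "v k" "2 ^ t"] order_trans by fastforce
      then show "a \<in> {..<nat \<lfloor>2 ^ t * v k\<rfloor>}" by (simp add: le_floor_iff zless_nat_eq_int_zless) linarith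
    qed
    then have "card (S k t) \<le> nat \<lfloor>2 ^ t * v k\<rfloor>"
      using card_mono[of "{..<nat \<lfloor>2 ^ t * v k\<rfloor>}" "S k t"] by simp
    then have "real (card (S k t)) \<le> real (nat \<lfloor>2 ^ t * v k\<rfloor>)" by simp
    also have "\<dots> \<le> 2 ^ t * v k" using v(1)[of k] by (intro of_nat_floor) simp
    finally have "real (card (S k t)) \<le> 2 ^ t * v k" .
    then show ?thesis unfolding g by (simp add: field_simps)
  qed
  have lower: "q j - 1 / 2 ^ t \<le> real (g (prod_encode (k, t))) / 2 ^ t"
    if "R (prod_encode (k, j)) u" "j < t" "u < t" for j u k t
  proof -
    have qj: "0 \<le> q j" "q j \<le> 1"
      using order_trans[OF R'[OF that(1)] v(2)] by (simp_all add: q_def)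
    have "{..<nat \<lfloor>2 ^ t * q j\<rfloor>} \<subseteq> S k t"
    proof
      fix a assume "a \<in> {..<nat \<lfloor>2 ^ t * q j\<rfloor>}"
      then have a: "real (Suc a) \<le> 2 ^ t * q j"
        by (simp add: zless_nat_eq_int_zless) linarith
      also have "2 ^ t * q j \<le> 2 ^ t * 1" using qj by (intro mult_left_mono) auto
      finally have "real (Suc a) \<le> real (2 ^ t)" by simp
      then have "a < 2 ^ t" by (simp only: of_nat_le_iff)
      with a that show "a \<in> S k t" by (auto simp: S_def)
    qed
    then have "nat \<lfloor>2 ^ t * q j\<rfloor> \<le> card (S k t)"
      using card_mono[OF fin, of "{..<nat \<lfloor>2 ^ t * q j\<rfloor>}"] by simp
    then have "2 ^ t * q j - 1 \<le> real (card (S k t))" by linarith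
    then have "(2 ^ t * q j - 1) / 2 ^ t \<le> real (card (S k t)) / 2 ^ t"
      by (rule divide_right_mono) simp
    then show ?thesis unfolding g by (simp add: diff_divide_distrib)
  qed
  have lim: "(\<lambda>t. real (g (prod_encode (k, t))) / 2 ^ t) \<longlonglongrightarrow> v k" for k
  proof (rule LIMSEQ_I)
    fix \<epsilon> :: real assume \<epsilon>: "\<epsilon> > 0"
    obtain r where r: "v k - \<epsilon> / 2 < of_rat r" "of_rat r < v k"
      using of_rat_dense[of "v k - \<epsilon> / 2" "v k"] \<epsilon> by auto
    obtain j where j: "nat_to_rat_surj j = r" using surj_nat_to_rat_surj by (metis surjD)
    obtain u where u: "R (prod_encode (k, j)) u"
      using R(2)[of "prod_encode (k, j)"] r(2) j by auto
    obtain m where m: "1 / 2 ^ m < \<epsilon> / 2" using ex_inverse_two_power_less[of "\<epsilon> / 2"] \<epsilon> by auto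
    have "norm (real (g (prod_encode (k, t))) / 2 ^ t - v k) < \<epsilon>" if "t \<ge> m + Suc j + Suc u" for t
    proof -
      have "(1::real) / 2 ^ t \<le> 1 / 2 ^ m" using that by (intro divide_left_mono power_increasing) auto
      moreover have "of_rat r \<le> q j" by (simp add: q_def j)
      ultimately show ?thesis
        using lower[OF u, of t] upper[of k t] r m that by (simp add: abs_if)
    qed
    then show "\<exists>no. \<forall>t\<ge>no. norm (real (g (prod_encode (k, t))) / 2 ^ t - v k) < \<epsilon>" by blast
  qed
  have "rec_in A g"
    unfolding g_def[abs_def] S_def mem_Collect_eq
    by (intro rec_in_intros dec_in_intros dec_in_apply2[OF R(1)] dec_in_rat_le rat_in_intros
        rat_in_compose[OF q])
  then show ?thesis unfolding lower_seq_def using upper lim by blast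
qed

lemma computable_seq_compose:
  assumes "computable_seq A v" "rec_in A f" shows "computable_seq A (\<lambda>k. v (f k))"
proof -
  obtain q where q: "rat_in A q" "\<And>k m. \<bar>v k - q (prod_encode (k, m))\<bar> \<le> 1 / 2 ^ m"
    using assms(1) unfolding computable_seq_def by blast
  have "rat_in A (\<lambda>z. q (prod_encode (f (pfst z), psnd z)))"
    by (intro rat_in_compose[OF q(1)] rec_in_compose[OF assms(2)] rec_in_intros)
  then show ?thesis
    unfolding computable_seq_def using q(2)
    by (intro exI[of _ "\<lambda>z. q (prod_encode (f (pfst z), psnd z))"]) simp
qed

lemma computable_seq_search_small:
  assumes "computable_seq A v" "v \<longlonglongrightarrow> 0"
  shows "\<exists>f. rec_in A f \<and> (\<forall>k. v (f k) \<le> 1 / 2 ^ k)"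
proof -
  obtain q where q: "rat_in A q" "\<And>k m. \<bar>v k - q (prod_encode (k, m))\<bar> \<le> 1 / 2 ^ m"
    using assms(1) unfolding computable_seq_def by blast
  \<comment> \<open>Comparing \<open>v\<close> itself with 1/2^k is not decidable, so an
    approximation is compared instead. With precision k + 2, a term below 1/2^(k+2) passes, since
    the left side is then at most 3/2^(k+2).\<close>
  have "\<exists>f. rec_in A f \<and> (\<forall>k. q (prod_encode (f k, k + 2)) + 1 / 2 ^ (k + 2) \<le> 1 / 2 ^ k)"
  proof (rule rec_in_search)
    show "dec_in A (\<lambda>z. q (prod_encode (psnd z, pfst z + 2)) + 1 / 2 ^ (pfst z + 2) \<le> 1 / 2 ^ pfst z)"
      by (intro dec_in_rat_le rat_in_intros rat_in_compose[OF q(1)] rec_in_intros)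
    fix k :: nat
    have "eventually (\<lambda>i. v i < 1 / 2 ^ (k + 2)) sequentially"
      by (rule order_tendstoD(2)[OF assms(2)]) simp
    then obtain i where "v i < 1 / 2 ^ (k + 2)" by (auto dest: eventually_happens)
    then have "q (prod_encode (i, k + 2)) + 1 / 2 ^ (k + 2) \<le> 3 * (1 / 2 ^ (k + 2))"
      using q(2)[of i "k + 2"] by linarith
    also have "\<dots> \<le> 1 / 2 ^ k" by (simp add: field_simps)
    finally show "\<exists>i. q (prod_encode (i, k + 2)) + 1 / 2 ^ (k + 2) \<le> 1 / 2 ^ k" ..
  qed
  then obtain f where f: "rec_in A f" "\<And>k. q (prod_encode (f k, k + 2)) + 1 / 2 ^ (k + 2) \<le> 1 / 2 ^ k"
    by blast
  have "v (f k) \<le> 1 / 2 ^ k" for k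
    using f(2)[of k] q(2)[of "f k" "k + 2"] by linarith
  with f(1) show ?thesis by blast
qed

text \<open>
  The value of the sum is computable, so lower approximations of all other summands turn into
  upper approximations of \<open>v m\<close>.
\<close>

lemma computable_seq_of_lower_sum:
  assumes v: "lower_seq A v" and w: "lower_seq A w" and c: "computable_seq A (\<lambda>_. c)"
    and sum: "\<And>m. v m + (\<Sum>j<m. w j) + real m * c = real m + 1"
  shows "computable_seq A v"
proof -
  obtain g where g: "rec_in A g" "\<And>k t. real (g (prod_encode (k, t))) / 2 ^ t \<le> v k"
     "\<And>k. (\<lambda>t. real (g (prod_encode (k, t))) / 2 ^ t) \<longlonglongrightarrow> v k"
    using v unfolding lower_seq_def by blast
  obtain h where h: "rec_in A h" "\<And>k t. real (h (prod_encode (k, t))) / 2 ^ t \<le> w k"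
     "\<And>k. (\<lambda>t. real (h (prod_encode (k, t))) / 2 ^ t) \<longlonglongrightarrow> w k"
    using w unfolding lower_seq_def by blast
  obtain q' where q': "rat_in A q'" "\<And>k m. \<bar>c - q' (prod_encode (k, m))\<bar> \<le> 1 / 2 ^ m"
    using c unfolding computable_seq_def by blast
  define q where "q t = q' (prod_encode (0, t))" for t
  have q: "rat_in A q" unfolding q_def[abs_def]
    by (intro rat_in_compose[OF q'(1)] rec_in_intros)
  have qc: "\<bar>c - q t\<bar> \<le> 1 / 2 ^ t" for t unfolding q_def by (rule q'(2))
  \<comment> \<open>For z = (m, k), wait until the lower bounds come within 1/2^k of the known total
    m + 1. The extra m/2^t pays for replacing m copies of \<open>c\<close> by \<open>q t\<close>.
    The bound for \<open>v m\<close> is then accurate to 1/2^k, since the other summands are bounded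
    by their true values.\<close>
  define good where "good z t \<longleftrightarrow> real (pfst z) + 1 + real (pfst z) * (1 / 2 ^ t) \<le>
      real (g (prod_encode (pfst z, t)) + (\<Sum>j<pfst z. h (prod_encode (j, t)))) / 2 ^ t
        + real (pfst z) * q t + 1 / 2 ^ psnd z" for z t
  have "\<exists>f. rec_in A f \<and> (\<forall>z. good z (f z))"
  proof (rule rec_in_search)
    show "dec_in A (\<lambda>z. good (pfst z) (psnd z))"
      unfolding good_def
      by (intro dec_in_rat_le rat_in_intros rec_in_intros rec_in_compose[OF g(1)]
          rec_in_compose[OF h(1)] rat_in_compose[OF q])
    fix z
    define m where "m = pfst z"
    have e: "(\<lambda>t. 1 / 2 ^ t :: real) \<longlonglongrightarrow> 0"
      using LIMSEQ_divide_realpow_zero[of 2 1] by simp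
    have "(\<lambda>t. q t) \<longlonglongrightarrow> c"
    proof (rule Lim_transform[of "\<lambda>_. c"])
      show "(\<lambda>t. q t - c) \<longlonglongrightarrow> 0"
        using qc by (intro Lim_null_comparison[OF _ e]) (simp add: abs_minus_commute)
    qed simp
    \<comment> \<open>The slack in the condition converges to 1/2^k, so the waiting ends.\<close>
    then have "(\<lambda>t. real (g (prod_encode (m, t))) / 2 ^ t + (\<Sum>j<m. real (h (prod_encode (j, t))) / 2 ^ t)
        + real m * q t + 1 / 2 ^ psnd z - (real m + 1 + real m * (1 / 2 ^ t))) \<longlonglongrightarrow>
        v m + (\<Sum>j<m. w j) + real m * c + 1 / 2 ^ psnd z - (real m + 1 + real m * 0)"
      by (intro tendsto_intros g h e)
    then have "eventually (\<lambda>t. 0 < real (g (prod_encode (m, t))) / 2 ^ t + (\<Sum>j<m. real (h (prod_encode (j, t))) / 2 ^ t)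
        + real m * q t + 1 / 2 ^ psnd z - (real m + 1 + real m * (1 / 2 ^ t))) sequentially"
      by (rule order_tendstoD(1)) (simp add: sum)
    then obtain t where "0 < real (g (prod_encode (m, t))) / 2 ^ t + (\<Sum>j<m. real (h (prod_encode (j, t))) / 2 ^ t)
        + real m * q t + 1 / 2 ^ psnd z - (real m + 1 + real m * (1 / 2 ^ t))"
      by (auto dest: eventually_happens)
    then have "good z t"
      unfolding good_def m_def by (simp add: add_divide_distrib sum_divide_distrib)
    then show "\<exists>t. good z t" ..
  qed
  then obtain f where f: "rec_in A f" "\<And>z. good z (f z)" by blast
  define r where "r z = real (g (prod_encode (pfst z, f z))) / 2 ^ f z" for z
  have "\<bar>v m - r (prod_encode (m, k))\<bar> \<le> 1 / 2 ^ k" for m k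
  proof -
    define z where "z = prod_encode (m, k)"
    define t where "t = f z"
    have "real m + 1 + real m * (1 / 2 ^ t) \<le>
        real (g (prod_encode (m, t)) + (\<Sum>j<m. h (prod_encode (j, t)))) / 2 ^ t + real m * q t + 1 / 2 ^ k"
      using f(2)[of z] by (simp add: good_def z_def t_def)
    also have "\<dots> = r z + (\<Sum>j<m. real (h (prod_encode (j, t))) / 2 ^ t) + real m * q t + 1 / 2 ^ k"
      by (simp add: r_def z_def t_def add_divide_distrib sum_divide_distrib)
    also have "\<dots> \<le> r z + (\<Sum>j<m. w j) + real m * q t + 1 / 2 ^ k"
      by (intro add_mono sum_mono h(2) order_refl)
    finally have 1: "real m + 1 + real m * (1 / 2 ^ t) \<le> r z + (\<Sum>j<m. w j) + real m * q t + 1 / 2 ^ k" .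
    have "real m * q t \<le> real m * (c + 1 / 2 ^ t)"
      using qc[of t] by (intro mult_left_mono) auto
    then have "v m \<le> r z + 1 / 2 ^ k"
      using 1 sum[of m] by (simp add: distrib_left)
    moreover have "r z \<le> v m" unfolding r_def z_def using g(2) by simp
    ultimately show ?thesis unfolding z_def[symmetric] by simp
  qed
  moreover have "rat_in A r"
    unfolding r_def[abs_def] by (intro rat_in_intros rec_in_intros rec_in_compose[OF g(1)] f(1))
  ultimately show ?thesis unfolding computable_seq_def by blast
qed

section \<open>Effectively open sets\<close>

lemma pos_rat_pos [simp]: "pos_rat j > 0"
  by (simp add: pos_rat_def)

lemma pos_rat_between:
  assumes "0 \<le> a" "a < b" shows "\<exists>l. a < pos_rat l \<and> pos_rat l < b"
proof -
  obtain r where r: "r \<in> \<rat>" "a < r" "r < b"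
    using Rats_dense_in_real[OF assms(2)] by blast
  obtain m n :: nat where mn: "n \<noteq> 0" "\<bar>r\<bar> = real m / real n"
    using Rats_abs_nat_div_natE[OF r(1)] by metis
  have "m \<noteq> 0" using mn r assms(1) by (intro notI) simp
  then have "pos_rat (prod_encode (m - 1, n - 1)) = r"
    using mn r assms(1) by (simp add: pos_rat_def)
  with r show ?thesis by blast
qed

lemma UN_prod_encode:
  "(\<Union>i\<in>I. \<Union>l\<in>{l. Q i l}. F (prod_encode (i, l))) = (\<Union>w\<in>{w. pfst w \<in> I \<and> Q (pfst w) (psnd w)}. F w)"
proof (intro set_eqI iffI)
  fix x assume "x \<in> (\<Union>i\<in>I. \<Union>l\<in>{l. Q i l}. F (prod_encode (i, l)))"
  then obtain i l where "i \<in> I" "Q i l" "x \<in> F (prod_encode (i, l))" by blast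
  then show "x \<in> (\<Union>w\<in>{w. pfst w \<in> I \<and> Q (pfst w) (psnd w)}. F w)"
    by (intro UN_I[of "prod_encode (i, l)"]) auto
next
  fix x assume "x \<in> (\<Union>w\<in>{w. pfst w \<in> I \<and> Q (pfst w) (psnd w)}. F w)"
  then obtain w where "pfst w \<in> I" "Q (pfst w) (psnd w)" "x \<in> F w" by blast
  then show "x \<in> (\<Union>i\<in>I. \<Union>l\<in>{l. Q i l}. F (prod_encode (i, l)))"
    by (intro UN_I[of "pfst w"] UN_I[of "psnd w"]) auto
qed

lemma sigma_set_cong: "ce_set A e = ce_set A e' \<Longrightarrow> sigma_set s A (Suc n) e = sigma_set s A (Suc n) e'"
  by (cases n) auto

lemma open_sigma_set: "open (sigma_set s A (Suc 0) e)"
  by (auto simp: ideal_ball_def)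

lemma sigma_set_1_index:
  assumes "ce_in A (\<lambda>z. P (pfst z) (psnd z))"
  shows "\<exists>h. rec_in {} h \<and> (\<forall>e. sigma_set s A (Suc 0) (h e) = (\<Union>i\<in>{i. P e i}. ideal_ball s i))"
  using ce_in_uniform_index[OF assms] by auto

lemma sigma_set_Suc_index:
  assumes "ce_in A (\<lambda>z. P (pfst z) (psnd z))"
  shows "\<exists>h. rec_in {} h \<and> (\<forall>e. sigma_set s A (Suc (Suc n)) (h e) = (\<Union>i\<in>{i. P e i}. - sigma_set s A (Suc n) i))"
  using ce_in_uniform_index[OF assms] by auto

lemma sigma_set_1_Un_index:
  "\<exists>h. rec_in {} h \<and> (\<forall>e. sigma_set s A (Suc 0) (h e) = sigma_set s A (Suc 0) u \<union> sigma_set s A (Suc 0) e)"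
proof -
  have "ce_in A (\<lambda>z. psnd z \<in> ce_set A u \<or> psnd z \<in> ce_set A (pfst z))"
    by (intro ce_in_intros ce_in_ce_set rec_in_intros)
  from sigma_set_1_index[OF this, of s] show ?thesis by (simp add: Collect_disj_eq UN_Un)
qed

locale effective_metric_space =
  fixes s :: "nat \<Rightarrow> 'a::polish_space"
  assumes computable_metric_space: "computable_metric_space s"
begin

lemma ex_dense_point: "\<epsilon> > 0 \<Longrightarrow> \<exists>k. dist (s k) z < \<epsilon>"
  using computable_metric_space closure_approachable[of z "range s"]
  unfolding computable_metric_space_def by auto

lemma ex_ideal_ball:
  assumes "\<epsilon> > 0" shows "\<exists>k. z \<in> ideal_ball s k \<and> pos_rat (psnd k) < \<epsilon>"
proof -
  obtain l where l: "pos_rat l < \<epsilon>" using pos_rat_between[of 0 \<epsilon>] assms by auto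
  obtain i where "dist (s i) z < pos_rat l" using ex_dense_point[of "pos_rat l"] by auto
  with l show ?thesis
    by (intro exI[of _ "prod_encode (i, l)"]) (simp add: ideal_ball_def)
qed

lemma Union_ideal_ball: "(\<Union>k. ideal_ball s k) = UNIV"
  using ex_ideal_ball[of 1] by auto

text \<open>The index set expresses formal inclusion, an enumerable condition on centres and radii
  that implies inclusion of the balls. Density provides enough small balls to cover the
  intersection.\<close>

lemma ideal_ball_Int:
  "ideal_ball s i \<inter> ideal_ball s j =
    (\<Union>k\<in>{k. dist (s (pfst k)) (s (pfst i)) + pos_rat (psnd k) < pos_rat (psnd i) \<and>
             dist (s (pfst k)) (s (pfst j)) + pos_rat (psnd k) < pos_rat (psnd j)}. ideal_ball s k)"
  (is "_ = (\<Union>k\<in>?K. _)")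
proof (intro set_eqI iffI)
  fix z assume z: "z \<in> ideal_ball s i \<inter> ideal_ball s j"
  define \<epsilon> where "\<epsilon> = min (pos_rat (psnd i) - dist (s (pfst i)) z) (pos_rat (psnd j) - dist (s (pfst j)) z)"
  \<comment> \<open>The margin is halved because the radius of the small ball is used twice: once
    for the distance to its centre and once as the radius itself.\<close>
  have "\<epsilon> / 2 > 0" using z by (auto simp: ideal_ball_def \<epsilon>_def)
  then obtain k where k: "z \<in> ideal_ball s k" "pos_rat (psnd k) < \<epsilon> / 2"
    using ex_ideal_ball by blast
  have "dist (s (pfst k)) (s l) \<le> dist (s (pfst k)) z + dist (s l) z" for l
    by (rule dist_triangle2)
  from this[of "pfst i"] this[of "pfst j"] have "k \<in> ?K"
    using k by (simp add: ideal_ball_def \<epsilon>_def)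
  with k show "z \<in> (\<Union>k\<in>?K. ideal_ball s k)" by blast
next
  fix z assume "z \<in> (\<Union>k\<in>?K. ideal_ball s k)"
  then obtain k where k: "k \<in> ?K" "z \<in> ideal_ball s k" by blast
  have "dist (s l) z \<le> dist (s (pfst k)) (s l) + dist (s (pfst k)) z" for l
    by (metis dist_commute dist_triangle)
  from this[of "pfst i"] this[of "pfst j"] show "z \<in> ideal_ball s i \<inter> ideal_ball s j"
    using k by (simp add: ideal_ball_def)
qed

text \<open>Formal disjointness from a closed ball is enumerable, so complements of closed ideal
  balls are effectively open, uniformly in the ball.\<close>

lemma cball_complement_eq:
  "{z. pos_rat l < dist (s i) z} =
    (\<Union>k\<in>{k. pos_rat l + pos_rat (psnd k) < dist (s i) (s (pfst k))}. ideal_ball s k)"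
  (is "_ = (\<Union>k\<in>?K. _)")
proof (intro set_eqI iffI)
  fix z assume z: "z \<in> {z. pos_rat l < dist (s i) z}"
  then obtain k where k: "z \<in> ideal_ball s k" "pos_rat (psnd k) < (dist (s i) z - pos_rat l) / 2"
    using ex_ideal_ball[of "(dist (s i) z - pos_rat l) / 2" z] by auto
  have "dist (s i) z \<le> dist (s i) (s (pfst k)) + dist (s (pfst k)) z"
    by (rule dist_triangle)
  then have "k \<in> ?K" using k by (simp add: ideal_ball_def field_simps)
  with k show "z \<in> (\<Union>k\<in>?K. ideal_ball s k)" by blast
next
  fix z assume "z \<in> (\<Union>k\<in>?K. ideal_ball s k)"
  then obtain k where k: "k \<in> ?K" "z \<in> ideal_ball s k" by blast
  have "dist (s i) (s (pfst k)) \<le> dist (s i) z + dist (s (pfst k)) z"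
    by (rule dist_triangle2)
  then show "z \<in> {z. pos_rat l < dist (s i) z}" using k by (simp add: ideal_ball_def)
qed

text \<open>An open ball is exhausted by closed balls with the same centre and smaller rational
  radii. Together with the preceding lemma this presents open sets at level 2, the base case of the
  jump argument.\<close>

lemma ideal_ball_eq_Union:
  "ideal_ball s i = (\<Union>l\<in>{l. pos_rat l < pos_rat (psnd i)}. - {z. pos_rat l < dist (s (pfst i)) z})"
proof (intro set_eqI iffI)
  fix z assume "z \<in> ideal_ball s i"
  then obtain l where "dist (s (pfst i)) z < pos_rat l" "pos_rat l < pos_rat (psnd i)"
    using pos_rat_between[of "dist (s (pfst i)) z" "pos_rat (psnd i)"] by (auto simp: ideal_ball_def)
  then show "z \<in> (\<Union>l\<in>{l. pos_rat l < pos_rat (psnd i)}. - {z. pos_rat l < dist (s (pfst i)) z})"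
    by auto
qed (auto simp: ideal_ball_def)

lemma computable_seq_dist: "computable_seq A (\<lambda>k. dist (s (pfst k)) (s (psnd k)))"
  using computable_metric_space unfolding computable_metric_space_def
  by (auto intro: computable_seq_empty[OF computable_seqD])

lemma ce_in_dist_less:
  assumes "rec_in A a" "rec_in A b" "rec_in A c" "rec_in A d"
  shows "ce_in A (\<lambda>x. dist (s (a x)) (s (b x)) + pos_rat (c x) < pos_rat (d x))"
  using ce_in_computable_seq_less[OF computable_seq_dist rec_in_pair[OF assms(1,2)]
      rat_in_pos_rat[OF assms(3)] rat_in_pos_rat[OF assms(4)]] by simp

lemma ce_in_less_dist:
  assumes "rec_in A a" "rec_in A b" "rec_in A c" "rec_in A d"
  shows "ce_in A (\<lambda>x. pos_rat (c x) + pos_rat (d x) < dist (s (a x)) (s (b x)))"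
  using ce_in_less_computable_seq[OF computable_seq_dist rec_in_pair[OF assms(1,2)]
      rat_in_add[OF rat_in_pos_rat[OF assms(3)] rat_in_pos_rat[OF assms(4)]]] by simp

lemma sigma_set_1_Int_index:
  "\<exists>h. rec_in {} h \<and> (\<forall>e. sigma_set s A (Suc 0) (h e) = sigma_set s A (Suc 0) u \<inter> sigma_set s A (Suc 0) e)"
proof -
  define P where "P e k \<longleftrightarrow> (\<exists>i j. (i \<in> ce_set A u \<and> j \<in> ce_set A e) \<and>
     dist (s (pfst k)) (s (pfst i)) + pos_rat (psnd k) < pos_rat (psnd i) \<and>
     dist (s (pfst k)) (s (pfst j)) + pos_rat (psnd k) < pos_rat (psnd j))" for e k
  have "ce_in A (\<lambda>z. P (pfst z) (psnd z))"
    unfolding P_def by (intro ce_in_intros ce_in_ce_set ce_in_dist_less rec_in_intros)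
  from sigma_set_1_index[OF this, of s] obtain h where
    h: "rec_in {} h" "\<And>e. sigma_set s A (Suc 0) (h e) = (\<Union>i\<in>{i. P e i}. ideal_ball s i)" by blast
  have "(\<Union>i\<in>{i. P e i}. ideal_ball s i) = (\<Union>i\<in>ce_set A u. \<Union>j\<in>ce_set A e. ideal_ball s i \<inter> ideal_ball s j)" for e
    unfolding ideal_ball_Int P_def by blast
  then have "sigma_set s A (Suc 0) (h e) = sigma_set s A (Suc 0) u \<inter> sigma_set s A (Suc 0) e" for e
    unfolding h(2) by auto
  with h(1) show ?thesis by blast
qed

text \<open>Above level 1 the reason is that the empty set is among the sets whose complements are
  united. Such indices serve as the replacement sets in the next lemma.\<close>

lemma sigma_set_eq_UNIV:
  assumes "ce_set A e = UNIV" shows "sigma_set s A (Suc n) e = UNIV"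
proof (cases n)
  case 0 then show ?thesis using assms Union_ideal_ball by simp
next
  case (Suc m)
  have "ce_in A (\<lambda>_. False)" by (intro ce_in_dec dec_in_const)
  then obtain e0 where "ce_set A e0 = {}"
    using ce_in_uniform_index[of A "\<lambda>_ _. False"] by auto
  then have "sigma_set s A (Suc m) e0 = {}" by (cases m) auto
  then show ?thesis using Suc assms by auto
qed

text \<open>
  A \<open>\<Pi>\<^sub>1(A)\<close> side condition on the index can be absorbed into the complemented sets of the
  union: those violating it are replaced by the complement of the whole space.
\<close>

lemma sigma_set_jump_Union:
  assumes c: "rec_in {} c" and W: "ce_in (turing_jump A) (\<lambda>z. W (pfst z) (psnd z))"
  shows "\<exists>h. rec_in {} h \<and>
    (\<forall>e. sigma_set s A (Suc (Suc n)) (h e) = (\<Union>i\<in>{i. W e i}. - sigma_set s A (Suc n) (c i)))"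
proof -
  obtain R where R: "dec_in A (\<lambda>z. R (pfst z) (pfst (psnd z)) (psnd (psnd z)))"
    "\<And>z. W (pfst z) (psnd z) \<longleftrightarrow> (\<exists>y. \<forall>t. R z y t)"
    using W by (rule ce_in_turing_jump) blast
  have R': "dec_in A (\<lambda>x. R (a x) (b x) (d x))" if "rec_in A a" "rec_in A b" "rec_in A d" for a b d
    using dec_in_compose[OF R(1) rec_in_pair[OF that(1) rec_in_pair[OF that(2,3)]]] by simp
  \<comment> \<open>The set with index \<open>k w\<close> starts as a copy of the intended one; a
    counterexample \<open>t\<close> to the side condition makes it enumerate everything.\<close>
  have "ce_in A (\<lambda>z. psnd z \<in> ce_set A (c (psnd (pfst (pfst z)))) \<or>
      (\<exists>t. \<not> R (pfst (pfst z)) (psnd (pfst z)) t))"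
    by (intro ce_in_disj ce_in_ex_dec ce_in_ce_set dec_in_not R' rec_in_intros
        rec_in_compose[OF rec_in_empty[OF c]])
  from ce_in_uniform_index[OF this] obtain k where k: "rec_in {} k"
    "\<And>w. ce_set A (k w) = {j. j \<in> ce_set A (c (psnd (pfst w))) \<or> (\<exists>t. \<not> R (pfst w) (psnd w) t)}"
    by blast
  have kw: "sigma_set s A (Suc n) (k w) =
      (if \<forall>t. R (pfst w) (psnd w) t then sigma_set s A (Suc n) (c (psnd (pfst w))) else UNIV)" for w
  proof (cases "\<forall>t. R (pfst w) (psnd w) t")
    case True
    then have "ce_set A (k w) = ce_set A (c (psnd (pfst w)))" by (simp add: k(2))
    then show ?thesis
      using sigma_set_cong[of A "k w" "c (psnd (pfst w))"] True by (simp del: sigma_set.simps)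
  next
    case False
    then have "ce_set A (k w) = UNIV" by (auto simp: k(2))
    then show ?thesis
      using sigma_set_eq_UNIV[of A "k w" n] False by presburger
  qed
  \<comment> \<open>The union runs over all \<open>i\<close> and \<open>y\<close> without testing
    \<open>W\<close>: pairs violating the condition contribute the empty complement of the whole
    space.\<close>
  have "ce_in A (\<lambda>z. \<exists>i y. psnd z = k (prod_encode (prod_encode (pfst z, i), y)))"
    by (intro ce_in_ex ce_in_dec dec_in_eq rec_in_intros rec_in_compose[OF rec_in_empty[OF k(1)]])
  from sigma_set_Suc_index[OF this, of s n] obtain h where h: "rec_in {} h"
    "\<And>e. sigma_set s A (Suc (Suc n)) (h e) =
      (\<Union>j\<in>{j. \<exists>i y. j = k (prod_encode (prod_encode (e, i), y))}. - sigma_set s A (Suc n) j)"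
    by blast
  have "sigma_set s A (Suc (Suc n)) (h e) = (\<Union>i\<in>{i. W e i}. - sigma_set s A (Suc n) (c i))" for e
  proof -
    have "W e i \<longleftrightarrow> (\<exists>y. \<forall>t. R (prod_encode (e, i)) y t)" for i
      using R(2)[of "prod_encode (e, i)"] by simp
    moreover have "sigma_set s A (Suc (Suc n)) (h e) =
        (\<Union>i. \<Union>y. - sigma_set s A (Suc n) (k (prod_encode (prod_encode (e, i), y))))"
      unfolding h(2) by blast
    moreover have "sigma_set s A (Suc n) (k (prod_encode (prod_encode (e, i), y))) =
        (if \<forall>t. R (prod_encode (e, i)) y t then sigma_set s A (Suc n) (c i) else UNIV)" for i y
      using kw[of "prod_encode (prod_encode (e, i), y)"] by (simp only: prod_encode_inverse fst_conv snd_conv)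
    moreover have "(\<Union>i. \<Union>y. - (if Q i y then S i else UNIV)) = (\<Union>i\<in>{i. \<exists>y. Q i y}. - S i)"
      for Q and S :: "nat \<Rightarrow> 'a set"
    proof -
      have "x \<in> (if Q i y then S i else UNIV) \<longleftrightarrow> (Q i y \<longrightarrow> x \<in> S i)" for x i y by simp
      then show ?thesis by (intro set_eqI; simp; blast)
    qed
    ultimately show ?thesis by (simp only:)
  qed
  with h(1) show ?thesis by blast
qed

text \<open>One jump costs one level: the extra quantifier in enumerating indices from the jump is
  absorbed by \<open>sigma_set_jump_Union\<close>. At level 1 balls are first replaced by unions of
  closed balls; higher up, the induction hypothesis translates the complemented sets.\<close>

lemma sigma_set_turing_jump:
  "\<exists>h. rec_in {} h \<and> (\<forall>e. sigma_set s A (Suc (Suc n)) (h e) = sigma_set s (turing_jump A) (Suc n) e)"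
proof (induction n)
  case 0
  have "ce_in A (\<lambda>z. pos_rat (psnd (pfst z)) + pos_rat (psnd (psnd z)) <
      dist (s (pfst (pfst (pfst z)))) (s (pfst (psnd z))))"
    by (intro ce_in_less_dist rec_in_intros)
  from sigma_set_1_index[OF this, of s] obtain c where c: "rec_in {} c"
    "\<And>w. sigma_set s A (Suc 0) (c w) = {z. pos_rat (psnd w) < dist (s (pfst (pfst w))) z}"
    unfolding cball_complement_eq by blast
  have "ce_in (turing_jump A) (\<lambda>z. pfst (psnd z) \<in> ce_set (turing_jump A) (pfst z) \<and>
      pos_rat (psnd (psnd z)) < pos_rat (psnd (pfst (psnd z))))"
    by (intro ce_in_conj ce_in_ce_set ce_in_dec dec_in_rat_less rat_in_pos_rat rec_in_intros)
  from sigma_set_jump_Union[OF c(1) this, of 0] obtain h where h: "rec_in {} h"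
    "\<And>e. sigma_set s A (Suc (Suc 0)) (h e) =
      (\<Union>i\<in>{i. pfst i \<in> ce_set (turing_jump A) e \<and> pos_rat (psnd i) < pos_rat (psnd (pfst i))}.
         - sigma_set s A (Suc 0) (c i))"
    by blast
  have "sigma_set s A (Suc (Suc 0)) (h e) = sigma_set s (turing_jump A) (Suc 0) e" for e
  proof -
    have "sigma_set s (turing_jump A) (Suc 0) e = (\<Union>i\<in>ce_set (turing_jump A) e. ideal_ball s i)"
      by simp
    also have "\<dots> = (\<Union>i\<in>ce_set (turing_jump A) e. \<Union>l\<in>{l. pos_rat l < pos_rat (psnd i)}.
         - {z. pos_rat l < dist (s (pfst i)) z})"
      by (intro SUP_cong refl ideal_ball_eq_Union)
    also have "\<dots> = (\<Union>i\<in>ce_set (turing_jump A) e. \<Union>l\<in>{l. pos_rat l < pos_rat (psnd i)}.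
         - sigma_set s A (Suc 0) (c (prod_encode (i, l))))"
      by (simp add: c(2) del: sigma_set.simps)
    also have "\<dots> = sigma_set s A (Suc (Suc 0)) (h e)"
      unfolding h(2) by (rule UN_prod_encode[where F = "\<lambda>w. - sigma_set s A (Suc 0) (c w)"])
    finally show ?thesis ..
  qed
  with h(1) show ?case by blast
next
  case (Suc n)
  then obtain c where c: "rec_in {} c"
    "\<And>e. sigma_set s A (Suc (Suc n)) (c e) = sigma_set s (turing_jump A) (Suc n) e" by blast
  have "ce_in (turing_jump A) (\<lambda>z. psnd z \<in> ce_set (turing_jump A) (pfst z))"
    by (intro ce_in_ce_set rec_in_intros)
  from sigma_set_jump_Union[OF c(1) this, of "Suc n"] show ?case
    unfolding c(2) by simp
qed

text \<open>The innermost jump is peeled off first, which is why the induction is over arbitrary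
  \<open>A\<close>.\<close>

lemma sigma_set_iterated_jump:
  "\<exists>h. rec_in {} h \<and> (\<forall>e. sigma_set s A (Suc n) (h e) = sigma_set s ((turing_jump ^^ n) A) (Suc 0) e)"
proof (induction n arbitrary: A)
  case 0
  then show ?case by (intro exI[of _ "\<lambda>x. x"]) (simp add: rec_in_id)
next
  case (Suc n)
  obtain g where g: "rec_in {} g"
    "\<And>e. sigma_set s (turing_jump A) (Suc n) (g e) =
       sigma_set s ((turing_jump ^^ n) (turing_jump A)) (Suc 0) e"
    using Suc[of "turing_jump A"] by blast
  obtain h where h: "rec_in {} h"
    "\<And>e. sigma_set s A (Suc (Suc n)) (h e) = sigma_set s (turing_jump A) (Suc n) e"
    using sigma_set_turing_jump by blast
  show ?case
    unfolding funpow_Suc_right o_apply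
    by (intro exI[of _ "\<lambda>e. h (g e)"]) (simp add: rec_in_compose g h del: sigma_set.simps)
qed

text \<open>Preimages commute with unions, so the oracle enters only through the enumeration of the
  balls, while the preimage of each ball has an oracle-free index.\<close>

lemma sigma_set_vimage_index:
  assumes "computable_map s D T"
  shows "\<exists>h. rec_in {} h \<and> (\<forall>e. D \<inter> sigma_set s A (Suc 0) (h e) = T -` sigma_set s A (Suc 0) e \<inter> D)"
proof -
  obtain f where f: "rec_in {} f" "\<And>i. T -` ideal_ball s i \<inter> D = D \<inter> sigma_set s {} (Suc 0) (f i)"
    using assms unfolding computable_map_def uniformly_def computable_fun_iff_rec_in by auto
  have "ce_in A (\<lambda>z. \<exists>i. i \<in> ce_set A (pfst z) \<and> psnd z \<in> ce_set {} (f i))"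
    by (intro ce_in_intros ce_in_ce_set ce_in_ce_set_empty rec_in_intros
        rec_in_compose[OF rec_in_empty[OF f(1)]])
  from sigma_set_1_index[OF this, of s] obtain h where h: "rec_in {} h"
    "\<And>e. sigma_set s A (Suc 0) (h e) =
      (\<Union>j\<in>{j. \<exists>i. i \<in> ce_set A e \<and> j \<in> ce_set {} (f i)}. ideal_ball s j)"
    by blast
  have "D \<inter> sigma_set s A (Suc 0) (h e) = T -` sigma_set s A (Suc 0) e \<inter> D" for e
  proof -
    have "T -` sigma_set s A (Suc 0) e \<inter> D = (\<Union>i\<in>ce_set A e. T -` ideal_ball s i \<inter> D)"
      by auto
    also have "\<dots> = D \<inter> sigma_set s A (Suc 0) (h e)"
      unfolding f(2) h(2) by auto
    finally show ?thesis ..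
  qed
  with h(1) show ?thesis by blast
qed

end

lemma mem_set_decode_less: "i \<in> set_decode k \<Longrightarrow> i < k"
proof -
  assume "i \<in> set_decode k"
  then have "k div 2 ^ i > 0" by (auto simp: set_decode_def intro: odd_pos)
  then have "2 ^ i \<le> k" by (simp add: div_greater_zero_iff)
  then show "i < k" using less_exp[of i] by linarith
qed

text \<open>By continuity from below, the measure of the union exceeds a rational iff that of some
  finite subunion does, and finite unions are covered by the definition of the space.\<close>

lemma lower_seq_measure_sigma_set:
  assumes "computable_prob_space s \<mu>"
  shows "lower_seq A (\<lambda>e. measure \<mu> (sigma_set s A (Suc 0) e))"
proof -
  interpret prob_space \<mu> using assms by (simp add: computable_prob_space_def)
  have [simp]: "sets \<mu> = sets borel" using assms by (simp add: computable_prob_space_def)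
  have meas: "open S \<Longrightarrow> S \<in> sets \<mu>" for S by simp
  have ball: "open (\<Union>i\<in>I. ideal_ball s i)" for I by (auto simp: ideal_ball_def)
  obtain f where f: "rec_in {} f"
    "\<And>k. ce_set {} (f k) = {j. of_rat (nat_to_rat_surj j) < measure \<mu> (\<Union>i\<in>set_decode k. ideal_ball s i)}"
    using assms
    unfolding computable_prob_space_def uniformly_def computable_fun_iff_rec_in lower_semicomputable_index_def
    by blast
  \<comment> \<open>Elements of a finite set lie below its canonical index, so inclusion in the
    enumerable set is a bounded quantifier.\<close>
  have "of_rat (nat_to_rat_surj j) < measure \<mu> (sigma_set s A (Suc 0) e) \<longleftrightarrow>
      (\<exists>k. (\<forall>i<k. i \<notin> set_decode k \<or> i \<in> ce_set A e) \<and> j \<in> ce_set {} (f k))" (is "?q < _ \<longleftrightarrow> ?R") for j e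
  proof
    assume less: "?q < measure \<mu> (sigma_set s A (Suc 0) e)"
    define F where "F n = (\<Union>i\<in>ce_set A e \<inter> {..<n}. ideal_ball s i)" for n
    have "(\<lambda>n. measure \<mu> (F n)) \<longlonglongrightarrow> measure \<mu> (\<Union>n. F n)"
      using meas ball by (intro finite_Lim_measure_incseq) (auto simp: F_def incseq_def)
    moreover have "(\<Union>n. F n) = sigma_set s A (Suc 0) e" by (auto simp: F_def)
    ultimately have "eventually (\<lambda>n. ?q < measure \<mu> (F n)) sequentially"
      using less by (auto intro: order_tendstoD)
    then obtain n where n: "?q < measure \<mu> (F n)" by (auto dest: eventually_happens)
    define k where "k = set_encode (ce_set A e \<inter> {..<n})"
    have k: "set_decode k = ce_set A e \<inter> {..<n}" by (simp add: k_def set_encode_inverse)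
    have "j \<in> ce_set {} (f k)" using n unfolding f(2) k F_def by simp
    then show ?R using k by blast
  next
    assume ?R
    then obtain k where k: "\<And>i. i < k \<Longrightarrow> i \<notin> set_decode k \<or> i \<in> ce_set A e" "j \<in> ce_set {} (f k)"
      by blast
    have "?q < measure \<mu> (\<Union>i\<in>set_decode k. ideal_ball s i)" using k(2) unfolding f(2) by simp
    also have "\<dots> \<le> measure \<mu> (sigma_set s A (Suc 0) e)"
    proof (rule finite_measure_mono)
      have "set_decode k \<subseteq> ce_set A e" using k(1) mem_set_decode_less by blast
      then show "(\<Union>i\<in>set_decode k. ideal_ball s i) \<subseteq> sigma_set s A (Suc 0) e" by auto
    qed (intro meas open_sigma_set)
    finally show "?q < measure \<mu> (sigma_set s A (Suc 0) e)" .
  qed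
  moreover have "ce_in A (\<lambda>z. \<exists>k. (\<forall>i<k. i \<notin> set_decode k \<or> i \<in> ce_set A (pfst z)) \<and> psnd z \<in> ce_set {} (f k))"
    by (intro ce_in_intros ce_in_ce_set ce_in_ce_set_empty ce_in_dec[OF dec_in_not] dec_in_set_decode rec_in_intros
        rec_in_compose[OF rec_in_empty[OF f(1)]])
  ultimately show ?thesis
    by (intro lower_seqI) simp_all
qed

section \<open>Recurrence for ergodic maps\<close>

lemma (in prob_space) prob_Int_full:
  assumes "A \<in> events" "D \<in> events" "prob D = 1"
  shows "prob (A \<inter> D) = prob A"
proof -
  have "prob A = prob (A \<inter> D) + prob (A - D)"
    using assms finite_measure_Union[of "A \<inter> D" "A - D"] by (simp add: Int_Diff_Un Int_Diff_disjoint)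
  moreover have "prob (A - D) \<le> prob (space M - D)"
    using assms sets.sets_into_space by (intro finite_measure_mono) auto
  moreover have "prob (space M - D) = 0" using assms by (simp add: prob_compl)
  ultimately show ?thesis using measure_nonneg[of M "A - D"] by linarith
qed

locale measure_preserving = prob_space \<mu> for \<mu> :: "'a::polish_space measure" +
  fixes D :: "'a set" and T :: "'a \<Rightarrow> 'a"
  assumes sets_eq_borel: "sets \<mu> = sets borel"
    and measure_preserving: "measure_preserving_map \<mu> D T"
begin

lemma space_eq_UNIV: "space \<mu> = UNIV"
  using sets_eq_imp_space_eq[OF sets_eq_borel] by simp

lemma vimage_event: "B \<in> events \<Longrightarrow> T -` B \<inter> D \<in> events"
  and prob_vimage: "B \<in> events \<Longrightarrow> prob (T -` B \<inter> D) = prob B"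
  and domain_closed: "x \<in> D \<Longrightarrow> T x \<in> D"
  using measure_preserving unfolding measure_preserving_map_def sets_eq_borel by auto

lemma domain_event: "D \<in> events" and prob_domain: "prob D = 1"
  using vimage_event[of UNIV] prob_vimage[of UNIV] prob_space sets.top[of \<mu>]
  by (auto simp: space_eq_UNIV)

lemma iterate_vimage:
  assumes "B \<in> events"
  shows "{x \<in> D. (T ^^ k) x \<in> B} \<in> events \<and> prob {x \<in> D. (T ^^ k) x \<in> B} = prob B"
proof (induction k)
  case 0
  have "{x \<in> D. x \<in> B} = B \<inter> D" by auto
  then show ?case using prob_Int_full[OF assms domain_event prob_domain] assms domain_event by auto
next
  case (Suc k)
  have eq: "{x \<in> D. (T ^^ Suc k) x \<in> B} = T -` {x \<in> D. (T ^^ k) x \<in> B} \<inter> D"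
    by (auto simp: funpow_swap1 domain_closed)
  from Suc have "{x \<in> D. (T ^^ k) x \<in> B} \<in> events" by blast
  from vimage_event[OF this] prob_vimage[OF this] Suc show ?case unfolding eq by (simp only:)
qed

text \<open>The points visiting \<open>Q\<close> infinitely often form a set \<open>E\<close> of
  measure at least that of \<open>Q\<close>, hence of full measure by ergodicity, and no point of
  \<open>E\<close> avoids \<open>Q\<close> at all positive times.\<close>

lemma ergodic_avoiding_tendsto_0:
  assumes "ergodic_map \<mu> D T" and Q: "Q \<in> events" "prob Q > 0"
  shows "(\<lambda>m. prob {x \<in> D. \<forall>k<m. (T ^^ Suc k) x \<notin> Q}) \<longlonglongrightarrow> 0"
proof -
  define H where "H k = {x \<in> D. (T ^^ k) x \<in> Q}" for k
  have H: "H k \<in> events" "prob (H k) = prob Q" for k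
    using iterate_vimage[OF Q(1)] by (auto simp: H_def)
  define F where "F m = (\<Union>k\<in>{m..}. H k)" for m
  have F: "F m \<in> events" for m unfolding F_def by (intro sets.countable_UN'' H) auto
  define E where "E = (\<Inter>m. F m)"
  have E: "E \<in> events" unfolding E_def by (intro sets.countable_INT' F) (auto simp: F)
  have "decseq F" unfolding decseq_def F_def by (intro allI impI UN_mono) auto
  then have "(\<lambda>m. prob (F m)) \<longlonglongrightarrow> prob E"
    unfolding E_def using F by (intro finite_Lim_measure_decseq) auto
  moreover have "prob Q \<le> prob (F m)" for m
    using finite_measure_mono[OF _ F, of "H m" m] H by (auto simp: F_def)
  ultimately have "prob Q \<le> prob E" by (intro LIMSEQ_le_const) auto
  \<comment> \<open>Visiting infinitely often does not depend on the starting time, so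
    \<open>E\<close> is invariant exactly, as \<open>ergodic_map\<close> demands, and not merely up
    to a null set.\<close>
  moreover have "T -` E \<inter> D = E"
  proof -
    have mem: "x \<in> E \<longleftrightarrow> x \<in> D \<and> (\<forall>m. \<exists>k\<ge>m. (T ^^ k) x \<in> Q)" for x
      by (auto simp: E_def F_def H_def)
    have "(\<forall>m. \<exists>k\<ge>m. (T ^^ k) (T x) \<in> Q) \<longleftrightarrow> (\<forall>m. \<exists>k\<ge>m. (T ^^ k) x \<in> Q)" for x
    proof -
      have "(\<forall>m. \<exists>k\<ge>m. R (Suc k)) \<longleftrightarrow> (\<forall>m. \<exists>k\<ge>m. R k)" for R :: "nat \<Rightarrow> bool"
        by (metis Suc_leD Suc_le_D Suc_le_mono)
      from this[of "\<lambda>k. (T ^^ k) x \<in> Q"] show ?thesis by (simp add: funpow_swap1)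
    qed
    then show ?thesis using domain_closed by (auto simp: mem)
  qed
  ultimately have "prob E = 1"
    using assms(1) Q(2) E unfolding ergodic_map_def sets_eq_borel by force
  define G where "G m = {x \<in> D. \<forall>k<m. (T ^^ Suc k) x \<notin> Q}" for m
  have G: "G m \<in> events" for m
  proof -
    have "G m = D - (\<Union>k\<in>{..<m}. H (Suc k))" by (auto simp: G_def H_def simp del: funpow.simps)
    then show ?thesis using H domain_event by auto
  qed
  have "decseq G" unfolding decseq_def G_def by (auto simp del: funpow.simps)
  then have "(\<lambda>m. prob (G m)) \<longlonglongrightarrow> prob (\<Inter>m. G m)"
    using G by (intro finite_Lim_measure_decseq) auto
  moreover have "prob (\<Inter>m. G m) = 0"
  proof -
    have "(\<Inter>m. G m) \<inter> E = {}"
    proof (intro equals0I)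
      fix x assume x: "x \<in> (\<Inter>m. G m) \<inter> E"
      \<comment> \<open>The index is 1 because a visit at time 0 does not contradict membership in
        the sets \<open>G m\<close>.\<close>
      then have "x \<in> F 1" by (auto simp: E_def)
      then obtain k where k: "k \<ge> 1" "(T ^^ k) x \<in> Q" by (auto simp: F_def H_def)
      then obtain j where "k = Suc j" by (cases k) auto
      moreover have "x \<in> G k" using x by blast
      ultimately show False using k(2) by (auto simp: G_def simp del: funpow.simps)
    qed
    then have "prob (\<Inter>m. G m) \<le> prob (space \<mu> - E)"
      by (intro finite_measure_mono sets.compl_sets E) (auto simp: space_eq_UNIV)
    then show ?thesis using prob_compl[OF E] \<open>prob E = 1\<close> measure_nonneg[of \<mu> "\<Inter>m. G m"] by linarith
  qed
  ultimately show ?thesis by (simp add: G_def)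
qed

end

section \<open>The test given by avoiding orbits\<close>

theorem theorem4p14:
  fixes s :: "nat \<Rightarrow> 'a::polish_space" and \<mu> :: "'a measure"
    and n :: nat and A :: "nat set" and x :: 'a
    and P D :: "'a set" and T :: "'a \<Rightarrow> 'a"
  assumes "computable_prob_space s \<mu>"
    and "n \<ge> 1"
    and "schnorr_random s \<mu> A n x"
    and "weakly_quasi_pi_generic s \<mu> A n x"
    and "is_pi s A n P" and "x \<in> P" and "measure \<mu> P > 0"
    and "measure_preserving_map \<mu> D T" and "computable_map s D T" and "ergodic_map \<mu> D T"
    and "x \<in> D"
  shows "\<exists>k>0. (T ^^ k) x \<in> P"
proof (rule ccontr)
  assume avoid: "\<not> (\<exists>k>0. (T ^^ k) x \<in> P)"
  interpret effective_metric_space s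
    using assms(1) by unfold_locales (simp add: computable_prob_space_def)
  interpret measure_preserving \<mu> D T
    using assms(1,8) by (simp add: computable_prob_space_def measure_preserving_def measure_preserving_axioms_def)
  define B where "B = (turing_jump ^^ (n - 1)) A"
  obtain Q where Q: "is_pi s B 1 Q" "Q \<subseteq> P" "prob Q > 0" "computable_real B (prob Q)"
    using assms(4,5,6) unfolding weakly_quasi_pi_generic_def B_def by blast
  let ?\<Sigma> = "sigma_set s B (Suc 0)"
  obtain u where u: "- Q = ?\<Sigma> u" using Q(1) unfolding is_pi_def is_sigma_def by auto
  have event: "?\<Sigma> e \<in> events" for e using open_sigma_set[of s B e] sets_eq_borel by auto
  have "Q = space \<mu> - ?\<Sigma> u" unfolding u[symmetric] by (auto simp: space_eq_UNIV)
  then have Q_event: "Q \<in> events" using sets.compl_sets[OF event[of u]] by simp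
  obtain hU where hU: "rec_in {} hU" "\<And>e. ?\<Sigma> (hU e) = ?\<Sigma> u \<union> ?\<Sigma> e"
    using sigma_set_1_Un_index by blast
  obtain hI where hI: "rec_in {} hI" "\<And>e. ?\<Sigma> (hI e) = ?\<Sigma> u \<inter> ?\<Sigma> e"
    using sigma_set_1_Int_index by blast
  obtain hT where hT: "rec_in {} hT" "\<And>e. D \<inter> ?\<Sigma> (hT e) = T -` ?\<Sigma> e \<inter> D"
    using sigma_set_vimage_index[OF assms(9)] by blast
  have "ce_in B (\<lambda>_. True)" by (intro ce_in_dec dec_in_const)
  then obtain i0 where "ce_set B i0 = UNIV"
    using ce_in_uniform_index[of B "\<lambda>_ _. True"] by auto
  then have i0: "?\<Sigma> i0 = UNIV" by (rule sigma_set_eq_UNIV)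

  \<comment> \<open>The recursion runs on indices rather than on sets, so uniformity in
    \<open>m\<close> is built in. What the open sets contain outside \<open>D\<close> is left open;
    \<open>D\<close> has full measure, so their measures are unaffected.\<close>
  define e where "e m = rec_nat i0 (\<lambda>_ y. hT (hI y)) m" for m
  have "rec_in {} e"
    unfolding e_def[abs_def]
    by (intro rec_in_rec rec_in_compose[OF hT(1)] rec_in_compose[OF hI(1)] rec_in_intros)
  then have rec_e: "rec_in B e" by (rule rec_in_empty)
  have avoiding: "D \<inter> ?\<Sigma> (e m) = {y \<in> D. \<forall>k<m. (T ^^ Suc k) y \<notin> Q}" for m
  proof (induction m)
    case 0 then show ?case using i0 by (simp add: e_def del: sigma_set.simps)
  next
    case (Suc m)
    have "D \<inter> ?\<Sigma> (e (Suc m)) = {y \<in> D. T y \<notin> Q \<and> T y \<in> D \<inter> ?\<Sigma> (e m)}"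
      using domain_closed
      by (auto simp: e_def hT(2) hI(2) u[symmetric] simp del: sigma_set.simps)
    also have "\<dots> = {y \<in> D. T y \<notin> Q \<and> (\<forall>k<m. (T ^^ Suc k) (T y) \<notin> Q)}"
      unfolding Suc using domain_closed by blast
    also have "\<dots> = {y \<in> D. \<forall>k<Suc m. (T ^^ Suc k) y \<notin> Q}"
      by (simp only: All_less_Suc2 funpow_simps_right o_apply funpow_0 id_apply)
    finally show ?case .
  qed

  define v where "v m = prob (?\<Sigma> (e m))" for m
  define w where "w m = prob (?\<Sigma> (hU (e m)))" for m
  have v_eq: "v m = prob (D \<inter> ?\<Sigma> (e m))" for m
    unfolding v_def using prob_Int_full[OF event domain_event prob_domain] by (simp add: Int_commute)
  have v_0: "v 0 = 1" using i0 prob_space by (simp add: v_def e_def space_eq_UNIV del: sigma_set.simps)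
  \<comment> \<open>Invariance replaces the preimage by the intersection, and inclusion-exclusion
    replaces the intersection by the union measured by \<open>w\<close>. Summing over
    \<open>m\<close> telescopes.\<close>
  have v_Suc: "v (Suc m) = 1 - prob Q + v m - w m" for m
  proof -
    have "v (Suc m) = prob (T -` ?\<Sigma> (hI (e m)) \<inter> D)"
      unfolding v_eq by (simp add: e_def hT(2) del: sigma_set.simps)
    also have "\<dots> = prob (?\<Sigma> u \<inter> ?\<Sigma> (e m))" using prob_vimage[OF event[of "hI (e m)"]] by (simp only: hI(2))
    also have "\<dots> = prob (?\<Sigma> u) + v m - w m"
      unfolding w_def v_def hU(2) using measure_Un3[of "?\<Sigma> u" \<mu> "?\<Sigma> (e m)"] event
      by (simp add: fmeasurable_eq_sets del: sigma_set.simps)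
    also have "prob (?\<Sigma> u) = 1 - prob Q"
      unfolding u[symmetric] using prob_compl[OF Q_event] by (simp add: space_eq_UNIV Compl_eq_Diff_UNIV)
    finally show ?thesis .
  qed
  have sum: "v m + (\<Sum>j<m. w j) + real m * prob Q = real m + 1" for m
    by (induction m) (simp_all add: v_0 v_Suc algebra_simps)
  have lower: "lower_seq B v" "lower_seq B w"
    unfolding v_def[abs_def] w_def[abs_def]
    by (intro lower_seq_compose[OF lower_seq_measure_sigma_set[OF assms(1)]] rec_e
        rec_in_compose[OF rec_in_empty[OF hU(1)] rec_e])+
  have "computable_seq B (\<lambda>_. prob Q)"
    using computable_real_imp_computable_seq[OF Q(4)] by simp
  from computable_seq_of_lower_sum[OF lower this sum] have v: "computable_seq B v" .
  have "v \<longlonglongrightarrow> 0"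
    unfolding v_eq[abs_def] avoiding by (rule ergodic_avoiding_tendsto_0[OF assms(10) Q_event Q(3)])
  from computable_seq_search_small[OF v this] obtain f where
    f: "rec_in B f" "\<And>k. v (f k) \<le> 1 / 2 ^ k" by blast

  \<comment> \<open>The subsequence \<open>f\<close> is computable only in \<open>B\<close>, but a
    test needs an oracle-free index function. The evaluation of \<open>f\<close> is therefore moved
    into the enumeration, which may use \<open>B\<close>, and \<open>h\<close> merely produces
    programs.\<close>
  have "ce_in B (\<lambda>z. psnd z \<in> ce_set B (e (f (pfst z))))"
    by (intro ce_in_ce_set rec_in_compose[OF rec_e] rec_in_compose[OF f(1)] rec_in_intros)
  from sigma_set_1_index[OF this, of s] obtain h where
    h: "rec_in {} h" "\<And>k. ?\<Sigma> (h k) = ?\<Sigma> (e (f k))" by auto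
  obtain g where g: "rec_in {} g" "\<And>i. sigma_set s A n (g i) = ?\<Sigma> i"
    using sigma_set_iterated_jump[of A "n - 1"] assms(2) unfolding B_def by auto
  have "schnorr_test s \<mu> A n (\<lambda>k. ?\<Sigma> (e (f k)))"
    unfolding schnorr_test_def B_def[symmetric]
  proof (intro conjI allI)
    show "uniformly (\<lambda>i V. V = sigma_set s A n i) (\<lambda>k. ?\<Sigma> (e (f k)))"
      unfolding uniformly_def computable_fun_iff_rec_in
      by (intro exI[of _ "\<lambda>k. g (h k)"]) (simp add: rec_in_compose g h del: sigma_set.simps)
    show "prob (?\<Sigma> (e (f k))) \<le> 1 / 2 ^ k" for k using f(2)[of k] by (simp only: v_def)
    show "uniformly (computable_real_index B) (\<lambda>k. prob (?\<Sigma> (e (f k))))"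
      using computable_seq_imp_uniformly[OF computable_seq_compose[OF v f(1)]] by (simp only: v_def)
  qed
  moreover have "x \<in> ?\<Sigma> (e m)" for m
  proof -
    \<comment> \<open>The shift by \<open>Suc\<close> matches the claim, which concerns only
      positive times: even if \<open>x\<close> itself lies in \<open>Q\<close>, it stays in every
      set of the test.\<close>
    have "x \<in> {y \<in> D. \<forall>k<m. (T ^^ Suc k) y \<notin> Q}" using avoid Q(2) assms(11) by blast
    then show ?thesis unfolding avoiding[symmetric] by blast
  qed
  ultimately show False using assms(3) unfolding schnorr_random_def by blast
qed

end
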